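(* Let $\mathcal{U}\subseteq\mathcal{B}^\omega(\mathbb{N})$ be a family of infinite disjoint collections, let $\mathbf{s}\in\mathcal{B}^{<\omega}(\mathbb{N})$ and let $\mathcal{D}$ be an infinite disjoint collection. Then either there exists $\mathcal{D}_1<\mathcal{D}$ with $[\mathbf{s},\mathcal{D}_1]\subseteq\hat{\mathcal{U}}$; or there exists a countable ordinal $\xi_0$ such that for every countable ordinal $\xi>\xi_0$ there exists $\mathcal{D}_1<\mathcal{D}$ with $[\mathbf{s}\cup\mathbf{t},\mathcal{D}_1]\subseteq\mathcal{B}^\omega(\mathbb{N})\setminus\mathcal{U}$ for every $\mathbf{t}\in\mathcal{B}^\xi\cap\mathcal{B}^{<\omega}(\mathcal{D}_1)$.
   Context: $\mathbb{N}=\{1,2,\dots\}$. For nonempty $s,t\subseteq\mathbb{N}$ with $s$ finite, $s<t$ means $\max s<\min t$. A finite disjoint collection is a tuple $(s_1,\dots,s_k)$, $k\ge0$, of nonempty finite subsets of $\mathbb{N}$ with $s_1<\dots<s_k$; an infinite disjoint collection is a sequence $(s_n)_{n\in\mathbb{N}}$ of nonempty finite subsets with $s_n<s_{n+1}$; collections are identified with the set of their members. $\mathcal{B}^{<\omega}(\mathbb{N})$, $\mathcal{B}^\omega(\mathbb{N})$: the sets of finite, resp. infinite, disjoint collections. $FU(\mathcal{D})$: unions of finitely many (at least one) members of $\mathcal{D}$. $\mathcal{D}_1<\mathcal{D}$ means $\mathcal{D}_1\subseteq FU(\mathcal{D})$. $\mathcal{B}^{<\omega}(\mathcal{D})$: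 finite disjoint collections with all members in $FU(\mathcal{D})$ (including $\emptyset$). For a finite set $\mathbf{u}$ of finite sets, $\mathbf{u}\propto\mathcal{D}_1$ means $\mathbf{u}$ is an initial segment of $\mathcal{D}_1$; $\mathcal{D}_1-\bigcup_{F\in\mathbf{u}}F$ denotes the members $G$ of $\mathcal{D}_1$ with $\bigcup_{F\in\mathbf{u}}F<G$ (all of $\mathcal{D}_1$ if $\mathbf{u}=\emptyset$). $[\mathbf{u},\mathcal{D}]=\{\mathcal{D}_1\in\mathcal{B}^\omega(\mathbb{N}):\mathbf{u}\propto\mathcal{D}_1\text{ and }\mathcal{D}_1-\bigcup_{F\in\mathbf{u}}F<\mathcal{D}\}$. $\mathfrak{T}_E$ is the topology on $\mathcal{B}^\omega(\mathbb{N})$ with basic open sets $[\mathbf{s},\mathcal{D}]$, $\mathbf{s}\in\mathcal{B}^{<\omega}(\mathbb{N})$, $\mathcal{D}\in\mathcal{B}^\omega(\mathbb{N})$; $\hat{\mathcal{U}}$ is the closure of $\mathcal{U}$ in $\mathfrak{T}_E$. $\mathbf{s}\cup\mathbf{t}$ is the collection whose members are those of $\mathbf{s}$ and of $\mathbf{t}$. Schreier families: fix for each countable limit $\lambda>0$ a strictly increasing sequence $(\lambda_n)$ of successor ordinals $<\lambda$ with supremum $\lambda$. $\mathcal{A}_0=\{\emptyset\}$; $\mathcal{A}_{\zeta+1}=\{\{n\}\cup s_1:s_1\in\mathcal{A}_\zeta,\{n\}<s_1\}$ ($\{n\}<\emptyset$ vacuous); $\mathcal{A}_{\omega^{\beta+1}}=\{s_1\cup\dots\cup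 s_n:s_1<\dots<s_n\in\mathcal{A}_{\omega^\beta},n=\min s_1\}$; for limit $\lambda>0$, $\mathcal{A}_{\omega^\lambda}=\{s:s\in\mathcal{A}_{\omega^{\lambda_n}},n=\min s\}$; for limit $\xi$ with $\omega^a<\xi<\omega^{a+1}$, $\xi=p\omega^a+\sum_{i=1}^m p_i\omega^{a_i}$ ($m\ge0$, $p,p_i\ge1$, $a>a_1>\dots>a_m>0$, $p>1$ or $m\ge1$): $\mathcal{A}_\xi=\{s_0\cup\dots\cup s_m:s_m<\dots<s_0,\ s_0=s^0_1\cup\dots\cup s^0_p$ with $s^0_1<\dots<s^0_p\in\mathcal{A}_{\omega^a}$, $s_i=s^i_1\cup\dots\cup s^i_{p_i}$ with $s^i_1<\dots<s^i_{p_i}\in\mathcal{A}_{\omega^{a_i}}\}$. $\mathcal{B}^0=\{\emptyset\}$; for $\xi\ge1$, $\mathcal{B}^\xi=\{(s_1,\dots,s_k):k\ge1,\ s_1<\dots<s_k,\ \{\min s_1,\dots,\min s_k\}\in\mathcal{A}_\xi\}$. *)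

theory Defs
  imports "HOL-Analysis.Analysis" "HOL-Library.Countable_Set_Type"
begin

section \<open>Countable ordinals\<close>

text \<open>The countable ordinals are realised as the points of the first uncountable cardinal,
  which the library represents as a well-order on a set of sets of natural numbers. By
  \<open>countable_below\<close> and \<open>uncountable_UNIV_cord\<close> below, the type is well-ordered in type
  omega one, that is, order-isomorphic to the set of all countable ordinals, with 0 as the
  least one.\<close>

typedef cord = "Field (cardSuc natLeq)"
proof -
  have "infinite (Field (cardSuc natLeq))"
    using cardSuc_finite[OF natLeq_Card_order] by (simp add: Field_natLeq)
  then show ?thesis
    by (metis ex_in_conv finite.emptyI)
qed

lemma Well_order_cardSuc_natLeq: "Well_order (cardSuc natLeq)"
  using cardSuc_Card_order[OF natLeq_Card_order] card_order_on_well_order_on by blast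

instantiation cord :: wellorder
begin

definition less_eq_cord :: "cord \<Rightarrow> cord \<Rightarrow> bool"
  where "a \<le> b \<longleftrightarrow> (Rep_cord a, Rep_cord b) \<in> cardSuc natLeq"

definition less_cord :: "cord \<Rightarrow> cord \<Rightarrow> bool"
  where "a < b \<longleftrightarrow> (Rep_cord a, Rep_cord b) \<in> cardSuc natLeq \<and> a \<noteq> b"

instance
proof
  have wo: "wo_rel (cardSuc natLeq)"
    using Well_order_cardSuc_natLeq by (simp add: wo_rel_def)
  have as: "antisym (cardSuc natLeq)" and tr: "trans (cardSuc natLeq)"
    and tot: "Total (cardSuc natLeq)" and re: "Refl (cardSuc natLeq)"
    using wo_rel.ANTISYM[OF wo] wo_rel.TRANS[OF wo] wo_rel.TOTAL[OF wo] wo_rel.REFL[OF wo] by auto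
  fix x y z :: cord
  show "(x < y) = (x \<le> y \<and> \<not> y \<le> x)"
    unfolding less_eq_cord_def less_cord_def
    by (metis (no_types) as antisymD Rep_cord_inject re refl_onD Rep_cord)
  show "x \<le> x" unfolding less_eq_cord_def by (meson Rep_cord re refl_onD)
  show "x \<le> z" if "x \<le> y" "y \<le> z" using that tr unfolding less_eq_cord_def by (meson transD)
  show "x = y" if "x \<le> y" "y \<le> x" using that as unfolding less_eq_cord_def
    by (meson Rep_cord_inject antisymD)
  show "x \<le> y \<or> y \<le> x" unfolding less_eq_cord_def
    using tot Rep_cord[of x] Rep_cord[of y] re unfolding total_on_def
    by (metis refl_onD)
next
  fix P :: "cord \<Rightarrow> bool" and a :: cord
  assume step: "\<And>x. (\<And>y. y < x \<Longrightarrow> P y) \<Longrightarrow> P x"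
  have "wf (cardSuc natLeq - Id)"
    using Well_order_cardSuc_natLeq by (simp add: well_order_on_def)
  then have "wf (inv_image (cardSuc natLeq - Id) Rep_cord)"
    by (rule wf_inv_image)
  then show "P a"
  proof (induction a rule: wf_induct_rule)
    case (less x)
    show ?case
      by (rule step, rule less) (auto simp: less_cord_def Rep_cord_inject)
  qed
qed

end

context
  includes cardinal_syntax
begin

lemma uncountable_UNIV_cord: "uncountable (UNIV :: cord set)"
proof
  assume "countable (UNIV :: cord set)"
  then have "countable (Rep_cord ` UNIV)" by simp
  then have "countable (Field (cardSuc natLeq))"
    using type_definition.Rep_range[OF type_definition_cord] by simp
  then have "|Field (cardSuc natLeq)| \<le>o natLeq"
    by (simp add: countable_card_le_natLeq)
  then have "cardSuc natLeq \<le>o natLeq"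
    using card_of_Field_ordIso[OF cardSuc_Card_order[OF natLeq_Card_order]]
    by (metis ordIso_ordLeq_trans ordIso_symmetric)
  then show False
    using cardSuc_greater[OF natLeq_Card_order] not_ordLess_ordLeq by blast
qed

lemma countable_below: "countable {..<a :: cord}"
proof -
  let ?r = "cardSuc natLeq"
  have "|underS ?r (Rep_cord a)| <o ?r"
    using card_of_underS[OF cardSuc_Card_order[OF natLeq_Card_order] Rep_cord] .
  then have "|underS ?r (Rep_cord a)| \<le>o natLeq"
    by (metis card_of_Card_order cardSuc_ordLeq_ordLess natLeq_Card_order)
  then have "countable (underS ?r (Rep_cord a))"
    by (simp add: countable_card_le_natLeq)
  moreover have "Rep_cord ` {..<a} \<subseteq> underS ?r (Rep_cord a)"
    by (auto simp: underS_def less_cord_def Rep_cord_inject)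
  ultimately show ?thesis
    by (metis countable_image_inj_on countable_subset inj_on_subset inj_on_def Rep_cord_inject)
qed

end

lemma countable_bounded:
  fixes X :: "cord set"
  assumes "countable X"
  shows "\<exists>b. \<forall>x\<in>X. x < b"
proof (rule ccontr)
  assume "\<not> ?thesis"
  then have "UNIV \<subseteq> (\<Union>x\<in>X. insert x {..<x})" by (force simp: not_less le_less)
  moreover have "countable (\<Union>x\<in>X. insert x {..<x})"
    using assms countable_below by auto
  ultimately show False using uncountable_UNIV_cord countable_subset by blast
qed

text \<open>Suprema are least upper bounds; by \<open>countable_bounded\<close> every countable set has one.\<close>

instantiation cord :: conditionally_complete_linorder
begin

definition "Sup (X :: cord set) = (LEAST z. \<forall>x\<in>X. x \<le> z)"
definition "Inf (X :: cord set) = (LEAST x. x \<in> X)"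
definition "sup (a :: cord) b = max a b"
definition "inf (a :: cord) b = min a b"

instance
proof
  fix x z :: cord and X :: "cord set"
  show "Inf X \<le> x" if "x \<in> X" "bdd_below X"
    using that by (simp add: Inf_cord_def Least_le)
  show "z \<le> Inf X" if "X \<noteq> {}" "\<And>x. x \<in> X \<Longrightarrow> z \<le> x"
    using that unfolding Inf_cord_def ex_in_conv[symmetric] by (rule LeastI2_ex)
  show "x \<le> Sup X" if "x \<in> X" "bdd_above X"
  proof -
    have "\<exists>z. \<forall>x\<in>X. x \<le> z" using that(2) by (auto simp: bdd_above_def)
    then have "\<forall>x\<in>X. x \<le> Sup X" unfolding Sup_cord_def by (rule LeastI_ex)
    then show ?thesis using that(1) by blast
  qed
  show "Sup X \<le> z" if "X \<noteq> {}" "\<And>x. x \<in> X \<Longrightarrow> x \<le> z"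
    using that unfolding Sup_cord_def by (intro Least_le) auto
qed (auto simp: sup_cord_def inf_cord_def)

end

lemma bdd_above_countable: "countable X \<Longrightarrow> bdd_above (X :: cord set)"
  using countable_bounded[of X] by (auto simp: bdd_above_def intro: less_imp_le)

definition cord_succ :: "cord \<Rightarrow> cord"
  where "cord_succ a = (LEAST b. a < b)"

lemma less_cord_succ: "a < cord_succ a"
  unfolding cord_succ_def using countable_bounded[of "{a}"] by (auto intro: LeastI)

lemma cord_succ_le_iff: "cord_succ a \<le> b \<longleftrightarrow> a < b"
  using less_cord_succ[of a] by (auto simp: cord_succ_def intro: Least_le)

lemma less_cord_succ_iff: "a < cord_succ b \<longleftrightarrow> a \<le> b"
  using cord_succ_le_iff[of b a] by (meson not_le)

instantiation cord :: "{zero, one, plus}"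
begin

definition "(0 :: cord) = (LEAST a. True)"
definition "(1 :: cord) = cord_succ 0"

text \<open>Ordinal addition: a + b is the supremum of a and of the successors of a + b' for b' < b.\<close>

function plus_cord :: "cord \<Rightarrow> cord \<Rightarrow> cord"
  where "plus_cord a b = Sup (insert a ((\<lambda>b'. cord_succ (plus_cord a b')) ` {..<b}))"
  by auto
termination
  by (relation "inv_image {(x, y). x < y} snd") (auto simp: wf)

declare plus_cord.simps [simp del]

instance ..

end

lemma zero_le_cord: "0 \<le> (a :: cord)"
  by (simp add: zero_cord_def Least_le)

lemma cord_plus_le_iff: "a + b \<le> c \<longleftrightarrow> a \<le> c \<and> (\<forall>b'<b. a + b' < c)" for a b c :: cord
proof -
  let ?X = "insert a ((\<lambda>b'. cord_succ (a + b')) ` {..<b})"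
  have "bdd_above ?X"
    by (intro bdd_above_countable countable_insert countable_image countable_below)
  then have "a + b \<le> c \<longleftrightarrow> (\<forall>x\<in>?X. x \<le> c)"
    by (subst plus_cord.simps) (rule cSup_le_iff, auto)
  then show ?thesis by (auto simp: cord_succ_le_iff)
qed

lemma cord_plus_strict: "b < b' \<Longrightarrow> a + b < a + b'" for a b b' :: cord
  using cord_plus_le_iff[THEN iffD1, OF order_refl, of a b'] by blast

lemma less_cord_plus_iff: "c < a + b \<longleftrightarrow> c < a \<or> (\<exists>b'<b. c \<le> a + b')" for a b c :: cord
  using cord_plus_le_iff[of a b c] by (meson not_le)

instance cord :: monoid_add
proof
  fix a b c :: cord
  have ext: "x = y" if "\<And>d. x \<le> d \<longleftrightarrow> y \<le> d" for x y :: cord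
    using that[of x] that[of y] by (intro antisym) simp_all
  show "a + 0 = a"
    by (rule ext) (use zero_le_cord in \<open>auto simp: cord_plus_le_iff leD\<close>)
  show "0 + a = a"
  proof (induction a rule: less_induct)
    case (less a)
    have "0 + a \<le> c \<longleftrightarrow> a \<le> c" for c
      unfolding cord_plus_le_iff[of 0 a c] using less.IH zero_le_cord[of c]
      by (metis leI order.strict_trans2 order.irrefl)
    then show ?case by (rule ext)
  qed
  show "a + b + c = a + (b + c)"
  proof (induction c rule: less_induct)
    case (less c)
    have "a + b + c \<le> d \<longleftrightarrow> a + (b + c) \<le> d" for d
    proof
      assume l: "a + b + c \<le> d"
      then have "a \<le> d" and ab: "a + b \<le> d" and bc: "\<forall>c'<c. a + (b + c') < d"
        using less cord_plus_le_iff[of "a + b" c d] cord_plus_le_iff[of a b d] by auto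
      show "a + (b + c) \<le> d"
        unfolding cord_plus_le_iff[of a "b + c"]
      proof (intro conjI allI impI)
        show "a \<le> d" by fact
        fix x assume "x < b + c"
        then consider "x < b" | c' where "c' < c" "x \<le> b + c'"
          unfolding less_cord_plus_iff by blast
        then show "a + x < d"
        proof cases
          case 1
          then show ?thesis using ab cord_plus_strict[of x b a] by (meson order_less_le_trans)
        next
          case 2
          then have "a + x \<le> a + (b + c')" by (metis cord_plus_strict le_less)
          then show ?thesis using bc 2(1) by (meson le_less_trans)
        qed
      qed
    next
      assume l: "a + (b + c) \<le> d"
      have "b \<le> b + c" using cord_plus_le_iff[THEN iffD1, OF order_refl] by blast
      then have "a + b \<le> a + (b + c)" by (metis cord_plus_strict le_less)
      moreover have "a + (b + c') < d" if "c' < c" for c'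
        using cord_plus_strict[OF cord_plus_strict[OF that, of b], of a] l by simp
      ultimately show "a + b + c \<le> d"
        unfolding cord_plus_le_iff[of "a + b" c d] using less l by auto
    qed
    then show ?case by (rule ext)
  qed
qed

lemma cord_succ_eq_plus_one: "cord_succ a = a + 1"
proof (rule antisym)
  have one: "b < 1 \<longleftrightarrow> b = 0" for b :: cord
    by (metis less_cord_succ_iff one_cord_def antisym zero_le_cord order_refl)
  show "cord_succ a \<le> a + 1"
    unfolding cord_succ_le_iff less_cord_plus_iff[of a a 1] by (auto simp: one intro: exI[of _ 0])
  show "a + 1 \<le> cord_succ a"
    by (auto simp: cord_plus_le_iff one less_cord_succ less_imp_le)
qed

definition is_successor :: "cord \<Rightarrow> bool"
  where "is_successor a \<longleftrightarrow> (\<exists>b. a = b + 1)"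

text \<open>Limit ordinals are required to be positive.\<close>

definition is_limit :: "cord \<Rightarrow> bool"
  where "is_limit a \<longleftrightarrow> 0 < a \<and> \<not> is_successor a"

abbreviation omult :: "nat \<Rightarrow> cord \<Rightarrow> cord"
  where "omult p a \<equiv> sum_list (replicate p a)"

text \<open>The power of omega with exponent a. The single recursive clause covers the zero, successor
  and limit exponents; the usual three clauses are \<open>omega_pow_0\<close>, \<open>omega_pow_succ\<close> and
  \<open>omega_pow_limit\<close>.\<close>

function omega_pow :: "cord \<Rightarrow> cord"
  where "omega_pow a = Sup (insert 1 (\<Union>b\<in>{..<a}. range (\<lambda>p. omult p (omega_pow b))))"
  by auto
termination
  by (relation "{(x, y). x < y}") (auto simp: wf)

declare omega_pow.simps [simp del]

lemma omega_pow_le_iff: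
  "omega_pow a \<le> c \<longleftrightarrow> 1 \<le> c \<and> (\<forall>b<a. \<forall>p. omult p (omega_pow b) \<le> c)"
proof -
  let ?X = "insert 1 (\<Union>b\<in>{..<a}. range (\<lambda>p. omult p (omega_pow b)))"
  have "bdd_above ?X"
    by (intro bdd_above_countable countable_insert countable_UN countable_below) auto
  then have "omega_pow a \<le> c \<longleftrightarrow> (\<forall>x\<in>?X. x \<le> c)"
    by (subst omega_pow.simps) (rule cSup_le_iff, auto)
  then show ?thesis by auto
qed

lemma one_le_omega_pow: "1 \<le> omega_pow a"
  using omega_pow_le_iff[THEN iffD1, OF order_refl] by blast

lemma omult_le_omega_pow: "a < b \<Longrightarrow> omult p (omega_pow a) \<le> omega_pow b"
  using omega_pow_le_iff[THEN iffD1, OF order_refl] by blast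

lemma less_plus_one: "a < a + 1" and less_plus_one_iff: "b < a + 1 \<longleftrightarrow> b \<le> a" for a b :: cord
  using less_cord_succ less_cord_succ_iff by (simp_all add: cord_succ_eq_plus_one)

lemma omega_pow_mono: "a \<le> b \<Longrightarrow> omega_pow a \<le> omega_pow b"
  unfolding omega_pow_le_iff[of a] using one_le_omega_pow omult_le_omega_pow order_less_le_trans by blast

lemma omult_mono: "a \<le> b \<Longrightarrow> omult p a \<le> omult p (b :: cord)"
proof (induction p)
  case (Suc p)
  have mono_left: "a + c \<le> b + c" for c
  proof (induction c rule: less_induct)
    case (less c)
    have "b \<le> b + c" and "\<forall>c'<c. b + c' < b + c"
      using cord_plus_le_iff[THEN iffD1, OF order_refl, of b c] by auto
    then show ?case
      unfolding cord_plus_le_iff[of a c] using less Suc.prems by (meson le_less_trans order_trans)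
  qed
  have "a + omult p a \<le> a + omult p b"
    using Suc.IH[OF Suc.prems] by (metis cord_plus_strict le_less)
  then show ?case using mono_left[of "omult p b"] by simp
qed simp

lemma omega_pow_0: "omega_pow 0 = 1"
  by (rule antisym) (auto simp: omega_pow_le_iff one_le_omega_pow zero_le_cord leD)

lemma omega_pow_succ: "omega_pow (a + 1) = (SUP p. omult p (omega_pow a))"
proof (rule antisym)
  have bdd: "bdd_above (range (\<lambda>p. omult p (omega_pow a)))"
    by (intro bdd_above_countable) auto
  have up: "omult p (omega_pow a) \<le> (SUP p. omult p (omega_pow a))" for p
    using cSup_upper[OF _ bdd] by auto
  show "omega_pow (a + 1) \<le> (SUP p. omult p (omega_pow a))"
    unfolding omega_pow_le_iff
  proof (intro conjI allI impI)
    show "1 \<le> (SUP p. omult p (omega_pow a))"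
      using up[of 1] one_le_omega_pow[of a] by simp
    fix b p assume "b < a + 1"
    then have "b \<le> a" by (simp add: less_plus_one_iff)
    then show "omult p (omega_pow b) \<le> (SUP p. omult p (omega_pow a))"
      using order_trans[OF omult_mono[OF omega_pow_mono] up] by blast
  qed
  have "omult p (omega_pow a) \<le> omega_pow (a + 1)" for p
    by (rule omult_le_omega_pow[OF less_plus_one])
  then show "(SUP p. omult p (omega_pow a)) \<le> omega_pow (a + 1)"
    by (intro cSUP_least) auto
qed

lemma omega_pow_limit:
  assumes "is_limit l"
  shows "omega_pow l = (SUP a\<in>{..<l}. omega_pow a)"
proof (rule antisym)
  have ne: "{..<l} \<noteq> {}" using assms by (auto simp: is_limit_def)
  have bdd: "bdd_above (omega_pow ` {..<l})"
    by (intro bdd_above_countable countable_image countable_below)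
  have up: "omega_pow a \<le> (SUP a\<in>{..<l}. omega_pow a)" if "a < l" for a
    using cSup_upper[OF _ bdd] that by auto
  show "omega_pow l \<le> (SUP a\<in>{..<l}. omega_pow a)"
    unfolding omega_pow_le_iff
  proof (intro conjI allI impI)
    show "1 \<le> (SUP a\<in>{..<l}. omega_pow a)"
      using up[of 0] assms one_le_omega_pow[of 0] by (auto simp: is_limit_def)
    fix b p assume "b < l"
    then have "b + 1 < l"
      using assms by (metis cord_succ_eq_plus_one cord_succ_le_iff is_limit_def is_successor_def
        le_less)
    moreover have "omult p (omega_pow b) \<le> omega_pow (b + 1)"
      by (rule omult_le_omega_pow[OF less_plus_one])
    ultimately show "omult p (omega_pow b) \<le> (SUP a\<in>{..<l}. omega_pow a)"
      using up by (meson order_trans)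
  qed
  show "(SUP a\<in>{..<l}. omega_pow a) \<le> omega_pow l"
    using ne by (intro cSUP_least) (auto intro: omega_pow_mono)
qed


section \<open>Disjoint collections\<close>

text \<open>The natural numbers of the source start at 1, so blocks are finite nonempty sets of
  positive numbers. The elementwise relation is max s < min t for nonempty s and t, and holds
  vacuously when one of them is empty.\<close>

definition block :: "nat set \<Rightarrow> bool"
  where "block s \<longleftrightarrow> finite s \<and> s \<noteq> {} \<and> 0 \<notin> s"

definition set_less :: "nat set \<Rightarrow> nat set \<Rightarrow> bool"  (infix \<open>\<lless>\<close> 50)
  where "s \<lless> t \<longleftrightarrow> (\<forall>x\<in>s. \<forall>y\<in>t. x < y)"

lemma set_less_iff_Max_Min:
  "finite s \<Longrightarrow> s \<noteq> {} \<Longrightarrow> finite t \<Longrightarrow> t \<noteq> {} \<Longrightarrow> s \<lless> t \<longleftrightarrow> Max s < Min t"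
  by (auto simp: set_less_def)

text \<open>Collections are identified with the set of their members.\<close>

definition fin_collections :: "nat set set set"
  where "fin_collections =
    {set ss | ss. (\<forall>s\<in>set ss. block s) \<and> sorted_wrt (\<lless>) ss}"

definition inf_collections :: "nat set set set"
  where "inf_collections =
    {range s | s :: nat \<Rightarrow> nat set. \<forall>n. block (s n) \<and> s n \<lless> s (Suc n)}"

definition FU :: "nat set set \<Rightarrow> nat set set"
  where "FU D = {\<Union>F | F. F \<subseteq> D \<and> finite F \<and> F \<noteq> {}}"

definition subcollection :: "nat set set \<Rightarrow> nat set set \<Rightarrow> bool"  (infix \<open>\<preceq>\<close> 50)
  where "D1 \<preceq> D \<longleftrightarrow> D1 \<subseteq> FU D"

definition fin_collections_in :: "nat set set \<Rightarrow> nat set set set"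
  where "fin_collections_in D = {t \<in> fin_collections. t \<subseteq> FU D}"

definition initial_segment :: "nat set set \<Rightarrow> nat set set \<Rightarrow> bool"
  where "initial_segment u D1 \<longleftrightarrow> u \<subseteq> D1 \<and> (\<forall>F\<in>u. \<forall>G\<in>D1. G \<lless> F \<longrightarrow> G \<in> u)"

definition tail_after :: "nat set set \<Rightarrow> nat set set \<Rightarrow> nat set set"
  where "tail_after D1 u = {G \<in> D1. \<Union>u \<lless> G}"

text \<open>The set [u, D].\<close>

definition basic_set :: "nat set set \<Rightarrow> nat set set \<Rightarrow> nat set set set"
  where "basic_set u D = {D1 \<in> inf_collections. initial_segment u D1 \<and> tail_after D1 u \<preceq> D}"

definition ellentuck :: "nat set set topology"
  where "ellentuck = topology_generated_by
    {basic_set s D | s D. s \<in> fin_collections \<and> D \<in> inf_collections}"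

text \<open>The sets [s, D] form a base of this topology, and its underlying space is the set of all
  infinite disjoint collections.\<close>

lemma inf_collections_chain:
  assumes "A \<in> inf_collections"
  obtains s :: "nat \<Rightarrow> nat set"
  where "A = range s" "\<And>n. block (s n)" "\<And>m n. m < n \<longleftrightarrow> s m \<lless> s n"
proof -
  obtain s :: "nat \<Rightarrow> nat set" where s: "A = range s" "\<And>n. block (s n)" "\<And>n. s n \<lless> s (Suc n)"
    using assms by (auto simp: inf_collections_def)
  have 1: "s m \<lless> s n" if "m < n" for m n
    using that
  proof (induction rule: strict_inc_induct)
    case (base i) then show ?case using s(3) by metis
  next
    case (step i)
    obtain x where "x \<in> s (Suc i)" using s(2) by (auto simp: block_def)
    then show ?case using step s(3)[of i] unfolding set_less_def by (meson less_trans)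
  qed
  have 2: "\<not> (s m \<lless> s n \<and> (s n \<lless> s m \<or> m = n))" for m n
    using s(2)[of m] s(2)[of n] unfolding block_def set_less_def
    by (metis all_not_in_conv less_asym)
  have "m < n \<longleftrightarrow> s m \<lless> s n" for m n
    using 1 2 by (metis linorder_neqE_nat)
  with that s show thesis by blast
qed

lemma inf_collections_cases:
  assumes "A \<in> inf_collections" "F \<in> A" "G \<in> A"
  shows "F = G \<or> F \<lless> G \<or> G \<lless> F"
  using assms(1)
proof (rule inf_collections_chain)
  fix s :: "nat \<Rightarrow> nat set" assume "A = range s" "\<And>m n. m < n \<longleftrightarrow> s m \<lless> s n"
  then show ?thesis using assms(2,3) by (metis imageE linorder_neqE_nat)
qed

lemma finite_subset_inf_collections:
  assumes "A \<in> inf_collections" "u \<subseteq> A" "finite u"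
  shows "u \<in> fin_collections"
  using assms(1)
proof (rule inf_collections_chain)
  fix s :: "nat \<Rightarrow> nat set"
  assume s: "A = range s" "\<And>n. block (s n)" "\<And>m n. m < n \<longleftrightarrow> s m \<lless> s n"
  have inj: "inj s" by (rule injI) (metis s(3) linorder_neqE_nat less_irrefl)
  define N where "N = s -` u"
  have N: "finite N" "s ` N = u"
    using assms s(1) inj by (auto simp: N_def intro: finite_vimageI)
  have "sorted_wrt (\<lless>) (map s (sorted_list_of_set N))"
    using strict_sorted_list_of_set[of N] by (simp add: sorted_wrt_map s(3)[symmetric])
  moreover have "set (map s (sorted_list_of_set N)) = u" using N by simp
  moreover have "\<forall>x\<in>u. block x" using s(2) N(2) by blast
  ultimately show ?thesis unfolding fin_collections_def by blast
qed

lemma basic_set_refine: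
  assumes A: "A \<in> basic_set s D" and v: "initial_segment v A" "s \<subseteq> v"
  shows "basic_set v A \<subseteq> basic_set s D"
proof
  fix A' assume "A' \<in> basic_set v A"
  then have A': "A' \<in> inf_collections" "initial_segment v A'" "tail_after A' v \<subseteq> FU A"
    by (auto simp: basic_set_def subcollection_def)
  have s: "A \<in> inf_collections" "initial_segment s A" "tail_after A s \<subseteq> FU D"
    using A by (auto simp: basic_set_def subcollection_def)
  have "initial_segment s A'"
    using A'(2) s(2) v unfolding initial_segment_def by blast
  moreover have "G \<in> FU D" if G: "G \<in> A'" "\<Union>s \<lless> G" for G
  proof (cases "G \<in> v")
    case True
    then have "G \<in> tail_after A s" using v(1) G(2) by (auto simp: tail_after_def initial_segment_def)
    then show ?thesis using s(3) by blast
  next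
    case False
    have "F \<lless> G" if "F \<in> v" for F
      using inf_collections_cases[OF A'(1), of F G] A'(2) that G(1) False
      unfolding initial_segment_def by blast
    then have "\<Union>v \<lless> G" by (auto simp: set_less_def)
    then have "G \<in> FU A" using A'(3) G(1) by (auto simp: tail_after_def)
    then obtain F where F: "G = \<Union>F" "F \<subseteq> A" "finite F" "F \<noteq> {}" by (auto simp: FU_def)
    have "H \<in> FU D" if "H \<in> F" for H
    proof -
      have "\<Union>s \<lless> H" using G(2) F(1) that by (auto simp: set_less_def)
      then show ?thesis using s(3) F(2) that by (auto simp: tail_after_def)
    qed
    then have "\<forall>H\<in>F. \<exists>E. H = \<Union>E \<and> E \<subseteq> D \<and> finite E \<and> E \<noteq> {}" by (simp add: FU_def)
    then obtain E where E: "\<forall>H\<in>F. H = \<Union>(E H) \<and> E H \<subseteq> D \<and> finite (E H) \<and> E H \<noteq> {}" by metis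
    have "\<Union>(\<Union>(E ` F)) = (\<Union>H\<in>F. \<Union>(E H))" by blast
    also have "\<dots> = (\<Union>H\<in>F. H)" using E by (intro SUP_cong) auto
    finally have "G = \<Union>(\<Union>(E ` F))" using F(1) by simp
    moreover have "\<Union>(E ` F) \<subseteq> D" "finite (\<Union>(E ` F))" "\<Union>(E ` F) \<noteq> {}" using E F(3,4) by auto
    ultimately show ?thesis unfolding FU_def by blast
  qed
  ultimately show "A' \<in> basic_set s D"
    using A'(1) by (auto simp: basic_set_def subcollection_def tail_after_def)
qed

lemma subset_FU: "D \<subseteq> FU D"
proof
  fix G assume "G \<in> D"
  then show "G \<in> FU D" unfolding FU_def by (intro CollectI exI[of _ "{G}"]) simp
qed

lemma openin_ellentuck:
  "openin ellentuck V \<longleftrightarrow>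
    (\<forall>A\<in>V. \<exists>s\<in>fin_collections. \<exists>D\<in>inf_collections. A \<in> basic_set s D \<and> basic_set s D \<subseteq> V)"
  (is "_ \<longleftrightarrow> ?R V")
proof
  let ?B = "{basic_set s D | s D. s \<in> fin_collections \<and> D \<in> inf_collections}"
  assume "openin ellentuck V"
  then have "generate_topology_on ?B V"
    unfolding ellentuck_def by (rule openin_topology_generated_by)
  then show "?R V"
  proof induction
    case (Int V W)
    show ?case
    proof
      fix A assume A: "A \<in> V \<inter> W"
      obtain s D where s: "s \<in> fin_collections" "A \<in> basic_set s D" "basic_set s D \<subseteq> V"
        using Int A by blast
      obtain t E where t: "t \<in> fin_collections" "A \<in> basic_set t E" "basic_set t E \<subseteq> W"
        using Int A by blast
      have A': "A \<in> inf_collections" "initial_segment s A" "initial_segment t A"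
        using s t by (auto simp: basic_set_def)
      then have v: "initial_segment (s \<union> t) A" by (auto simp: initial_segment_def)
      have "finite (s \<union> t)" using s(1) t(1) by (auto simp: fin_collections_def)
      then have "s \<union> t \<in> fin_collections"
        using v A'(1) finite_subset_inf_collections by (auto simp: initial_segment_def)
      moreover have "A \<in> basic_set (s \<union> t) A"
        using A'(1) v subset_FU by (auto simp: basic_set_def subcollection_def tail_after_def)
      moreover have "basic_set (s \<union> t) A \<subseteq> V \<inter> W"
        using basic_set_refine[OF s(2) v] basic_set_refine[OF t(2) v] s(3) t(3) by blast
      ultimately show "\<exists>s\<in>fin_collections. \<exists>D\<in>inf_collections.
          A \<in> basic_set s D \<and> basic_set s D \<subseteq> V \<inter> W"
        using A'(1) by blast
    qed
  next
    case (UN K)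
    show ?case
    proof
      fix A assume "A \<in> \<Union>K"
      then obtain V where "V \<in> K" "A \<in> V" by blast
      with UN.IH[of V] show "\<exists>s\<in>fin_collections. \<exists>D\<in>inf_collections.
          A \<in> basic_set s D \<and> basic_set s D \<subseteq> \<Union>K"
        by (meson Union_upper order_trans)
    qed
  next
    case (Basis B) then show ?case by blast
  qed simp
next
  assume R: "?R V"
  have "openin ellentuck (\<Union>{B. \<exists>s\<in>fin_collections. \<exists>D\<in>inf_collections. B = basic_set s D \<and> B \<subseteq> V})"
    by (rule openin_Union) (auto simp: ellentuck_def intro!: topology_generated_by_Basis)
  moreover have "\<Union>{B. \<exists>s\<in>fin_collections. \<exists>D\<in>inf_collections. B = basic_set s D \<and> B \<subseteq> V} = V"
    using R by blast
  ultimately show "openin ellentuck V" by simp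
qed

lemma topspace_ellentuck: "topspace ellentuck = inf_collections"
proof -
  have "{} \<in> fin_collections" unfolding fin_collections_def by (intro CollectI exI[of _ "[]"]) simp
  moreover have "A \<in> basic_set {} A" if "A \<in> inf_collections" for A
    using that subset_FU
    by (auto simp: basic_set_def initial_segment_def subcollection_def tail_after_def)
  ultimately show ?thesis
    unfolding ellentuck_def topology_generated_by_topspace by (auto simp: basic_set_def)
qed


section \<open>Schreier families\<close>

text \<open>A choice of fundamental sequences (indexed from 1) for all countable limit ordinals.\<close>

definition fundamental_sequences :: "(cord \<Rightarrow> nat \<Rightarrow> cord) \<Rightarrow> bool"
  where "fundamental_sequences L \<longleftrightarrow>
    (\<forall>l. is_limit l \<longrightarrow>
      strict_mono_on {1..} (L l) \<and>
      (\<forall>n\<ge>1. is_successor (L l n) \<and> L l n < l) \<and>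
      (SUP n\<in>{1..}. L l n) = l)"

lemma ex_fundamental_sequences: "\<exists>L. fundamental_sequences L"
proof -
  have "\<exists>f :: nat \<Rightarrow> cord. strict_mono_on {1..} f \<and> (\<forall>n\<ge>1. is_successor (f n) \<and> f n < l) \<and>
      (SUP n\<in>{1..}. f n) = l" if l: "is_limit l" for l
  proof -
    have step: "b + 1 < l" if "b < l" for b
      using that l by (metis cord_succ_eq_plus_one cord_succ_le_iff is_limit_def is_successor_def
        le_less)
    have ne: "{..<l} \<noteq> {}" using l by (auto simp: is_limit_def)
    define e where "e = from_nat_into {..<l}"
    have e: "range e = {..<l}"
      unfolding e_def using ne countable_below by (rule range_from_nat_into)
    define f :: "nat \<Rightarrow> cord" where "f = rec_nat 1 (\<lambda>n x. max x (e n) + 1)"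
    have f0: "f 0 = 1" and fS: "f (Suc n) = max (f n) (e n) + 1" for n by (auto simp: f_def)
    have lt: "f n < l" for n
    proof (induction n)
      case 0 then show ?case using step[of 0] l by (simp add: f0 is_limit_def)
    next
      case (Suc n) then show ?case using step e by (auto simp: fS max_def)
    qed
    have sc: "is_successor (f n)" if "n \<ge> 1" for n
      using that by (cases n) (auto simp: fS is_successor_def)
    have "f n < f (Suc n)" for n
      using less_plus_one[of "max (f n) (e n)"] unfolding fS by (meson le_less_trans max.cobounded1)
    then have mono: "strict_mono f" by (simp add: strict_mono_Suc_iff)
    have bdd: "bdd_above (f ` {1..})" by (intro bdd_above_countable) auto
    have "(SUP n\<in>{1..}. f n) = l"
    proof (rule antisym)
      show "(SUP n\<in>{1..}. f n) \<le> l" using lt by (intro cSUP_least) (auto intro: less_imp_le)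
      show "l \<le> (SUP n\<in>{1..}. f n)"
      proof (rule ccontr)
        assume "\<not> ?thesis"
        then obtain n where n: "e n = (SUP n\<in>{1..}. f n)" using e by (metis imageE lessThan_iff not_le)
        have "e n < f (Suc n)"
          using less_plus_one[of "max (f n) (e n)"] unfolding fS by (meson le_less_trans max.cobounded2)
        also have "f (Suc n) \<le> (SUP n\<in>{1..}. f n)" by (rule cSUP_upper[OF _ bdd]) simp
        finally show False using n by simp
      qed
    qed
    moreover have "strict_mono_on {1..} f"
      using mono by (auto simp: strict_mono_def strict_mono_on_def)
    ultimately show ?thesis using lt sc by blast
  qed
  then show ?thesis unfolding fundamental_sequences_def by metis
qed

text \<open>\<open>schreier L \<xi> s\<close> means that s belongs to the family with index \<open>\<xi>\<close>. Every index matches the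
  conclusion of exactly one rule, and the premises only concern smaller indices, so this is the
  recursive definition of the families. In the rule \<open>cnf\<close>, the index is
  p 0 copies of \<open>\<omega>\<close>-to-the-a 0, plus ..., plus p m copies of \<open>\<omega>\<close>-to-the-a m.\<close>

inductive schreier :: "(cord \<Rightarrow> nat \<Rightarrow> cord) \<Rightarrow> cord \<Rightarrow> nat set \<Rightarrow> bool"
  for L :: "cord \<Rightarrow> nat \<Rightarrow> cord"
  where
    zero: "schreier L 0 {}"
  | succ: "schreier L \<zeta> s \<Longrightarrow> 1 \<le> n \<Longrightarrow> {n} \<lless> s \<Longrightarrow> schreier L (\<zeta> + 1) ({n} \<union> s)"
  | omega_pow_succ:
      "1 \<le> n \<Longrightarrow> \<forall>i\<in>{1..n}. schreier L (omega_pow \<beta>) (s i) \<Longrightarrow>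
       \<forall>i\<in>{1..<n}. s i \<lless> s (Suc i) \<Longrightarrow> n = Min (s 1) \<Longrightarrow>
       schreier L (omega_pow (\<beta> + 1)) (\<Union>i\<in>{1..n}. s i)"
  | omega_pow_limit:
      "is_limit l \<Longrightarrow> schreier L (omega_pow (L l n)) s \<Longrightarrow> n = Min s \<Longrightarrow>
       schreier L (omega_pow l) s"
  | cnf:
      "\<forall>i\<le>m. 1 \<le> p i \<Longrightarrow> \<forall>i<m. a (Suc i) < a i \<Longrightarrow> 0 < a m \<Longrightarrow> 1 < p 0 \<or> 1 \<le> m \<Longrightarrow>
       \<forall>i\<le>m. \<forall>j\<in>{1..p i}. schreier L (omega_pow (a i)) (t i j) \<Longrightarrow>
       \<forall>i\<le>m. \<forall>j\<in>{1..<p i}. t i j \<lless> t i (Suc j) \<Longrightarrow>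
       \<forall>i\<le>m. s i = (\<Union>j\<in>{1..p i}. t i j) \<Longrightarrow>
       \<forall>i<m. s (Suc i) \<lless> s i \<Longrightarrow>
       schreier L (\<Sum>i\<leftarrow>[0..<Suc m]. omult (p i) (omega_pow (a i))) (\<Union>i\<le>m. s i)"

definition block_schreier :: "(cord \<Rightarrow> nat \<Rightarrow> cord) \<Rightarrow> cord \<Rightarrow> nat set set set"
  where "block_schreier L \<xi> =
    (if \<xi> = 0 then {{}}
     else {t \<in> fin_collections. t \<noteq> {} \<and> schreier L \<xi> (Min ` t)})"

end

theory Submission
  imports Defs
begin

text \<open>The families of finite collections indexed by countable ordinals play no role: the exact
  Ramsey dichotomy of Ellentuck type holds, that is, some \<open>D1\<close> below \<open>D\<close> and beyond \<open>s\<close> has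
  \<open>[s, D1]\<close> either contained in the closure of \<open>U\<close> or disjoint from \<open>U\<close>. In the second case
  \<open>[s \<union> t, D1] \<subseteq> [s, D1]\<close> for every finite \<open>t\<close> built from \<open>D1\<close>, so one \<open>D1\<close> serves all ordinals.

  For the dichotomy, a diagonal argument gives \<open>D0\<close> that decides, for every finite \<open>t\<close> built from
  it, whether \<open>[s \<union> t, D0]\<close> misses \<open>U\<close> or no \<open>[s \<union> t, D']\<close> with \<open>D'\<close> below \<open>D0\<close> does; call \<open>t\<close> bad
  in the latter case. If the empty collection is bad, then by Hindman's theorem every bad \<open>t\<close>
  has all its one-block extensions bad after shrinking, since a \<open>D'\<close> without bad extensions
  would make \<open>[s \<union> t, D']\<close> miss \<open>U\<close>. A second diagonal argument makes everything built from some
  \<open>D1\<close> bad, which says exactly that \<open>[s, D1]\<close> lies in the closure of \<open>U\<close>. Hindman's theorem is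
  proved by Baumgartner's method.\<close>

section \<open>Finite unions and tails\<close>

lemma set_less_Union_left: "\<Union>F \<lless> x \<longleftrightarrow> (\<forall>y\<in>F. y \<lless> x)"
  by (auto simp: set_less_def)

lemma set_less_Union_right: "x \<lless> \<Union>F \<longleftrightarrow> (\<forall>y\<in>F. x \<lless> y)"
  by (auto simp: set_less_def)

lemma set_less_trans: "a \<lless> b \<Longrightarrow> b \<lless> c \<Longrightarrow> b \<noteq> {} \<Longrightarrow> a \<lless> c"
  unfolding set_less_def by (meson all_not_in_conv less_trans)

lemma FU_I: "F \<subseteq> D \<Longrightarrow> finite F \<Longrightarrow> F \<noteq> {} \<Longrightarrow> \<Union>F \<in> FU D"
  by (auto simp: FU_def)

lemma FU_E:
  assumes "x \<in> FU D"
  obtains F where "x = \<Union>F" "F \<subseteq> D" "finite F" "F \<noteq> {}"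
  using assms by (auto simp: FU_def)

lemma FU_Un: "x \<in> FU D \<Longrightarrow> y \<in> FU D \<Longrightarrow> x \<union> y \<in> FU D"
  by (elim FU_E) (metis FU_I Union_Un_distrib Un_empty Un_least finite_UnI)

lemma Union_in_FU: "finite F \<Longrightarrow> F \<noteq> {} \<Longrightarrow> F \<subseteq> FU D \<Longrightarrow> \<Union>F \<in> FU D"
  by (induction F rule: finite_ne_induct) (auto intro: FU_Un)

lemma FU_least: "A \<subseteq> FU D \<Longrightarrow> FU A \<subseteq> FU D"
  by (auto elim!: FU_E intro!: Union_in_FU)

lemma subcollection_iff_FU: "A \<preceq> D \<longleftrightarrow> FU A \<subseteq> FU D"
  using FU_least subset_FU unfolding subcollection_def by blast

lemma subcollection_refl: "D \<preceq> D"
  by (simp add: subcollection_iff_FU)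

lemma subcollection_trans: "A \<preceq> B \<Longrightarrow> B \<preceq> C \<Longrightarrow> A \<preceq> C"
  by (auto simp: subcollection_iff_FU)

lemma finite_FU: "finite h \<Longrightarrow> finite (FU h)"
  by (rule finite_subset[of _ "Union ` Pow h"]) (auto simp: FU_def)

lemma set_less_FU: "\<forall>d\<in>D. a \<lless> d \<Longrightarrow> x \<in> FU D \<Longrightarrow> a \<lless> x"
  by (elim FU_E) (simp add: set_less_Union_right subset_iff)

text \<open>A finite union lies beyond \<open>\<Union>u\<close> exactly when each set in it does.
  This turns relations between tails into inclusions of sets of unions.\<close>

lemma FU_tail_after: "FU (tail_after D u) = {x \<in> FU D. \<Union>u \<lless> x}"
proof
  show "FU (tail_after D u) \<subseteq> {x \<in> FU D. \<Union>u \<lless> x}"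
    by (auto simp: tail_after_def elim!: FU_E intro!: FU_I simp: set_less_Union_right)
  show "{x \<in> FU D. \<Union>u \<lless> x} \<subseteq> FU (tail_after D u)"
    by (auto simp: tail_after_def elim!: FU_E intro!: FU_I simp: set_less_Union_right)
qed

lemma tail_after_subcollection: "tail_after D u \<preceq> D"
  by (simp add: subcollection_iff_FU FU_tail_after)

lemma block_inf_collections: "D \<in> inf_collections \<Longrightarrow> d \<in> D \<Longrightarrow> block d"
  by (auto simp: inf_collections_def)

lemma finite_Union_fin_collections: "u \<in> fin_collections \<Longrightarrow> finite (\<Union>u)"
  by (auto simp: fin_collections_def block_def)

lemma block_FU: "D \<in> inf_collections \<Longrightarrow> x \<in> FU D \<Longrightarrow> block x"
proof (elim FU_E)
  fix F assume "D \<in> inf_collections" "x = \<Union>F" "F \<subseteq> D" "finite F" "F \<noteq> {}"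
  moreover from this have "\<forall>y\<in>F. block y" using block_inf_collections by blast
  ultimately show "block x" by (fastforce simp: block_def)
qed

lemma set_less_block: "block x \<Longrightarrow> \<not> x \<lless> x"
  by (auto simp: block_def set_less_def)

section \<open>Chains of blocks and their tails\<close>

lemma chain_less:
  assumes "\<And>n. block (e n)" "\<And>n. e n \<lless> e (Suc n)" "m < n"
  shows "e m \<lless> e n"
  using assms(3)
proof (induction rule: strict_inc_induct)
  case (base i) then show ?case using assms(2) by metis
next
  case (step i)
  then show ?case using assms set_less_trans[of "e i" "e (Suc i)" "e n"] by (auto simp: block_def)
qed

text \<open>Every element of \<open>e n\<close> is at least \<open>n\<close>, so the chain
  eventually passes any finite set.\<close>

lemma chain_unbounded:
  assumes "\<And>n. block (e n)" "\<And>n. e n \<lless> e (Suc n)" "finite b"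
  shows "\<exists>n. b \<lless> e n"
proof -
  have le: "\<forall>x\<in>e n. n \<le> x" for n
  proof (induction n)
    case (Suc n)
    obtain y where y: "y \<in> e n" using assms(1)[of n] by (auto simp: block_def)
    then show ?case using Suc assms(2)[of n] unfolding set_less_def
      by (meson Suc_leI le_less_trans)
  qed simp
  \<comment> \<open>For empty \<open>b\<close> the value \<open>Max b\<close> is unspecified, but
    the claim is then vacuous.\<close>
  have "b \<lless> e (Suc (Max b))"
    unfolding set_less_def using le[of "Suc (Max b)"] Max_ge[OF assms(3)]
    by (meson Suc_le_eq le_less_trans)
  then show ?thesis ..
qed

lemma range_inf_collections:
  "(\<And>n. block (e n)) \<Longrightarrow> (\<And>n. e n \<lless> e (Suc n)) \<Longrightarrow> range e \<in> inf_collections"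
  by (auto simp: inf_collections_def)

lemma tail_after_inf_collections:
  assumes "D \<in> inf_collections" "finite (\<Union>u)"
  shows "tail_after D u \<in> inf_collections"
proof -
  obtain e where e: "D = range e" "\<And>n. block (e n)" "\<And>n. e n \<lless> e (Suc n)"
    using assms(1) by (auto simp: inf_collections_def)
  define k where "k = (LEAST n. \<Union>u \<lless> e n)"
  have k: "\<Union>u \<lless> e k" unfolding k_def using chain_unbounded[of e, OF e(2,3) assms(2)] by (rule LeastI_ex)
  have "\<Union>u \<lless> e n \<longleftrightarrow> k \<le> n" for n
  proof
    show "k \<le> n" if "\<Union>u \<lless> e n" unfolding k_def using that by (rule Least_le)
    show "\<Union>u \<lless> e n" if "k \<le> n"
      using k chain_less[of e k n, OF e(2,3)] e(2)[of k] that set_less_trans[of "\<Union>u" "e k" "e n"]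
      by (cases "k = n") (auto simp: block_def)
  qed
  then have "tail_after D u = range (\<lambda>n. e (k + n))"
    unfolding tail_after_def e(1) by (auto simp: le_iff_add)
  then show ?thesis using range_inf_collections[of "\<lambda>n. e (k + n)"] e by simp
qed

lemma inf_collections_nonempty: "D \<in> inf_collections \<Longrightarrow> \<exists>d. d \<in> D"
  by (auto simp: inf_collections_def)

section \<open>Fusion\<close>

text \<open>The common frame of all the diagonal arguments: \<open>h\<close> holds the blocks chosen
  so far, and \<open>D\<close> is the reservoir for all later ones. Since reservoirs shrink, every
  block from stage \<open>m\<close> on is built from \<open>D m\<close>.\<close>

lemma fusion:
  fixes Inv :: "nat set set \<Rightarrow> nat set set \<Rightarrow> bool"
  assumes D0: "D0 \<in> inf_collections" and init: "Inv {} D0"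
    and hereditary: "\<And>h D D'. Inv h D \<Longrightarrow> D' \<in> inf_collections \<Longrightarrow> D' \<preceq> D \<Longrightarrow> Inv h D'"
    and step: "\<And>h D. finite h \<Longrightarrow> D \<in> inf_collections \<Longrightarrow> D \<preceq> D0 \<Longrightarrow> Inv h D \<Longrightarrow>
      \<exists>e\<in>FU D. \<exists>D'\<in>inf_collections. D' \<preceq> D \<and> Inv (insert e h) D'"
  obtains e :: "nat \<Rightarrow> nat set" and D where "\<And>n. block (e n)" "\<And>m n. m < n \<Longrightarrow> e m \<lless> e n"
    "\<And>n. D n \<in> inf_collections" "\<And>n. D n \<preceq> D0" "\<And>m n. m \<le> n \<Longrightarrow> e n \<in> FU (D m)"
    "\<And>n. Inv (e ` {..<n}) (D n)" "range e \<in> inf_collections" "range e \<preceq> D0"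
proof -
  \<comment> \<open>States are pairs of chosen blocks and reservoir. The clause for
    \<open>n = 0\<close> forces an empty start, so that after \<open>n\<close> steps the chosen set
    is exactly the image of \<open>{..<n}\<close> under \<open>e\<close>.\<close>
  define P :: "nat \<Rightarrow> nat set set \<times> nat set set \<Rightarrow> bool" where
    "P n = (\<lambda>(h, D). (n = 0 \<longrightarrow> h = {}) \<and> finite h \<and> D \<in> inf_collections \<and> D \<preceq> D0 \<and> Inv h D)" for n
  define Q :: "nat \<Rightarrow> nat set set \<times> nat set set \<Rightarrow> nat set set \<times> nat set set \<Rightarrow> bool" where
    "Q n = (\<lambda>(h, D) (h', D'). \<exists>e\<in>FU D. h' = insert e h \<and> D' \<preceq> D \<and> (\<forall>d\<in>D'. e \<lless> d))" for n
  have "\<exists>f. \<forall>n. P n (f n) \<and> Q n (f n) (f (Suc n))"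
  proof (rule dependent_nat_choice)
    show "\<exists>x. P 0 x" using D0 init subcollection_refl by (auto simp: P_def)
  next
    fix x n assume "P n x"
    then obtain h D where x: "x = (h, D)" "finite h" "D \<in> inf_collections" "D \<preceq> D0" "Inv h D"
      by (auto simp: P_def)
    obtain e D' where e: "e \<in> FU D" "D' \<in> inf_collections" "D' \<preceq> D" "Inv (insert e h) D'"
      using step[OF x(2-5)] by blast
    \<comment> \<open>Cutting the reservoir beyond \<open>e\<close> makes all later blocks follow
      \<open>e\<close>.\<close>
    let ?D = "tail_after D' {e}"
    have "finite (\<Union>{e})" using block_FU[OF x(3) e(1)] by (simp add: block_def)
    then have D: "?D \<in> inf_collections" using tail_after_inf_collections[OF e(2)] by blast
    have "?D \<preceq> D" using tail_after_subcollection e(3) subcollection_trans by blast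
    then have "P (Suc n) (insert e h, ?D) \<and> Q n x (insert e h, ?D)"
      using x e D hereditary[OF e(4) D tail_after_subcollection] subcollection_trans
      unfolding P_def Q_def by (auto simp: tail_after_def)
    then show "\<exists>y. P (Suc n) y \<and> Q n x y" ..
  qed
  then obtain f where f: "\<And>n. P n (f n)" "\<And>n. Q n (f n) (f (Suc n))" by blast
  define D where "D n = snd (f n)" for n
  have "\<forall>n. \<exists>e. e \<in> FU (D n) \<and> fst (f (Suc n)) = insert e (fst (f n)) \<and> D (Suc n) \<preceq> D n \<and>
      (\<forall>d\<in>D (Suc n). e \<lless> d)"
    using f(2) unfolding Q_def D_def by (fastforce simp: case_prod_unfold)
  then obtain e where e: "\<And>n. e n \<in> FU (D n)" "\<And>n. fst (f (Suc n)) = insert (e n) (fst (f n))"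
    "\<And>n. D (Suc n) \<preceq> D n" "\<And>n d. d \<in> D (Suc n) \<Longrightarrow> e n \<lless> d"
    by metis
  have D: "D n \<in> inf_collections" "D n \<preceq> D0" "Inv (fst (f n)) (D n)" for n
    using f(1)[of n] by (auto simp: P_def D_def case_prod_unfold)
  have "fst (f n) = e ` {..<n}" for n
  proof (induction n)
    case 0 then show ?case using f(1)[of 0] by (auto simp: P_def)
  qed (simp add: e(2) lessThan_Suc)
  then have I: "Inv (e ` {..<n}) (D n)" for n using D(3) by metis
  have mono: "FU (D n) \<subseteq> FU (D m)" if "m \<le> n" for m n
    using lift_Suc_antimono_le[of "\<lambda>n. FU (D n)"] e(3) that by (simp add: subcollection_iff_FU)
  then have eD: "e n \<in> FU (D m)" if "m \<le> n" for m n using e(1) that by blast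
  have b: "block (e n)" for n using block_FU D(1) e(1) by blast
  have less: "e m \<lless> e n" if "m < n" for m n
    using set_less_FU[of "D (Suc m)" "e m" "e n"] e(4) eD that by simp
  have "range e \<in> inf_collections" using range_inf_collections b less by simp
  moreover have "range e \<preceq> D0"
  proof -
    have "FU (D 0) \<subseteq> FU D0" using D(2) subcollection_iff_FU by blast
    then show ?thesis using eD[of 0] unfolding subcollection_def by blast
  qed
  ultimately show thesis using that[OF b less D(1,2) eD I] by blast
qed

text \<open>Members of \<open>K\<close> are treated one after another; heredity preserves what was
  achieved for the earlier ones.\<close>

lemma finite_shrink:
  fixes \<Phi> :: "'a \<Rightarrow> nat set set \<Rightarrow> bool"
  assumes "finite K" "D \<in> inf_collections"
    and hereditary: "\<And>t E E'. \<Phi> t E \<Longrightarrow> E' \<in> inf_collections \<Longrightarrow> E' \<preceq> E \<Longrightarrow> \<Phi> t E'"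
    and dense: "\<And>t E. t \<in> K \<Longrightarrow> E \<in> inf_collections \<Longrightarrow> E \<preceq> D \<Longrightarrow>
      \<exists>E'\<in>inf_collections. E' \<preceq> E \<and> \<Phi> t E'"
  shows "\<exists>E\<in>inf_collections. E \<preceq> D \<and> (\<forall>t\<in>K. \<Phi> t E)"
  using assms(1) dense
proof (induction K rule: finite_induct)
  case empty
  then show ?case using assms(2) subcollection_refl by blast
next
  case (insert t K)
  obtain E where E: "E \<in> inf_collections" "E \<preceq> D" "\<forall>t\<in>K. \<Phi> t E"
    using insert.IH insert.prems by blast
  obtain E' where "E' \<in> inf_collections" "E' \<preceq> E" "\<Phi> t E'" using insert.prems E(1,2) by blast
  then show ?case using E hereditary subcollection_trans by (metis insert_iff)
qed

text \<open>Density for each single \<open>t\<close> yields one collection good for all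
  \<open>t\<close> built from it. By \<open>local\<close>, only the part of the collection beyond
  \<open>t\<close> matters, so each fusion stage has to treat only the finitely many
  \<open>t\<close> built from the blocks chosen so far.\<close>

lemma diagonal_collection:
  fixes \<Phi> :: "nat set set \<Rightarrow> nat set set \<Rightarrow> bool"
  assumes D0: "D0 \<in> inf_collections"
    and local: "\<And>t D D'. \<Phi> t D \<Longrightarrow> D' \<in> inf_collections \<Longrightarrow> finite (\<Union>t) \<Longrightarrow>
      FU (tail_after D' t) \<subseteq> FU D \<Longrightarrow> \<Phi> t D'"
    and dense: "\<And>t D. t \<in> fin_collections \<Longrightarrow> D \<in> inf_collections \<Longrightarrow> D \<preceq> D0 \<Longrightarrow>
      \<exists>D'\<in>inf_collections. D' \<preceq> D \<and> \<Phi> t D'"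
  shows "\<exists>D1\<in>inf_collections. D1 \<preceq> D0 \<and> (\<forall>t\<in>fin_collections_in D1. \<Phi> t D1)"
proof -
  define Inv where "Inv h D \<longleftrightarrow> (\<forall>t\<in>fin_collections_in h. \<Phi> t D)" for h D
  have her: "\<Phi> t D'" if "\<Phi> t D" "D' \<in> inf_collections" "D' \<preceq> D" "t \<in> fin_collections" for t D D'
    using local[OF that(1,2)] that(3,4) tail_after_subcollection[of D' t]
      finite_Union_fin_collections by (auto simp: subcollection_iff_FU)
  have shrink: "\<exists>E\<in>inf_collections. E \<preceq> D \<and> Inv h E"
    if "finite h" "D \<in> inf_collections" "D \<preceq> D0" for h D
  proof -
    have "finite (fin_collections_in h)"
      by (rule finite_subset[of _ "Pow (FU h)"]) (auto simp: fin_collections_in_def finite_FU that)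
    \<comment> \<open>The guard \<open>t \<in> fin_collections\<close> makes the property hereditary
      for every \<open>t\<close>, as \<open>finite_shrink\<close> demands; \<open>her\<close> covers
      finite collections only.\<close>
    then have "\<exists>E\<in>inf_collections. E \<preceq> D \<and>
        (\<forall>t\<in>fin_collections_in h. t \<in> fin_collections \<longrightarrow> \<Phi> t E)"
    proof (rule finite_shrink[OF _ that(2)])
      fix t E assume "t \<in> fin_collections_in h" "E \<in> inf_collections" "E \<preceq> D"
      then show "\<exists>E'\<in>inf_collections. E' \<preceq> E \<and> (t \<in> fin_collections \<longrightarrow> \<Phi> t E')"
        using dense[of t E] that(3) subcollection_trans[of E D D0] by (auto simp: fin_collections_in_def)
    qed (use her in blast)
    then show ?thesis by (auto simp: Inv_def fin_collections_in_def)
  qed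
  obtain D0' where D0': "D0' \<in> inf_collections" "D0' \<preceq> D0" "Inv {} D0'"
    using shrink[OF _ D0 subcollection_refl] by blast
  have her_Inv: "Inv h D'" if "Inv h D" "D' \<in> inf_collections" "D' \<preceq> D" for h D D'
    using that her by (auto simp: Inv_def fin_collections_in_def)
  have step: "\<exists>e\<in>FU D. \<exists>D'\<in>inf_collections. D' \<preceq> D \<and> Inv (insert e h) D'"
    if h: "finite h" "D \<in> inf_collections" "D \<preceq> D0'" "Inv h D" for h D
  proof -
    obtain d where "d \<in> FU D" using inf_collections_nonempty h(2) subset_FU by blast
    moreover have "finite (insert d h)" "D \<preceq> D0"
      using h(1,3) D0'(2) subcollection_trans by auto
    ultimately show ?thesis using shrink[of "insert d h" D] h(2) by blast
  qed
  obtain e :: "nat \<Rightarrow> nat set" and D where e: "\<And>n. block (e n)" "\<And>m n. m < n \<Longrightarrow> e m \<lless> e n"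
    "\<And>n. D n \<in> inf_collections" "\<And>n. D n \<preceq> D0'" "\<And>m n. m \<le> n \<Longrightarrow> e n \<in> FU (D m)"
    "\<And>n. Inv (e ` {..<n}) (D n)" "range e \<in> inf_collections" "range e \<preceq> D0'"
    by (rule fusion[of D0' Inv, OF D0'(1,3) her_Inv step]) (assumption | rule that)+
  have "\<Phi> t (range e)" if t: "t \<in> fin_collections_in (range e)" for t
  proof -
    have fin: "t \<in> fin_collections" "finite (\<Union>t)" and tFU: "t \<subseteq> FU (range e)"
      using t finite_Union_fin_collections by (auto simp: fin_collections_in_def)
    \<comment> \<open>With this \<open>k\<close>, \<open>t\<close> is built from the blocks before
      \<open>e k\<close>, while all blocks beyond \<open>t\<close> have index at least
      \<open>k\<close> and come from the reservoir \<open>D k\<close>.\<close>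
    define k where "k = (LEAST n. \<Union>t \<lless> e n)"
    have k: "\<Union>t \<lless> e k" unfolding k_def
      by (rule LeastI_ex, rule chain_unbounded[of e, OF e(1) e(2)[OF lessI] fin(2)])
    have k_le: "k \<le> n" if "\<Union>t \<lless> e n" for n unfolding k_def using that by (rule Least_le)
    \<comment> \<open>Otherwise \<open>e n\<close>, as a part of \<open>\<Union>t\<close>, would
      precede \<open>e k\<close> although \<open>k \<le> n\<close>.\<close>
    have "n < k" if n: "e n \<subseteq> \<Union>t" for n
    proof (rule ccontr)
      assume "\<not> n < k"
      then have "k = n \<or> e k \<lless> e n" using e(2)[of k n] by (cases k n rule: linorder_cases) auto
      moreover have "e n \<lless> e k" using k n by (auto simp: set_less_def)
      ultimately show False
        using e(1)[of k] set_less_block[OF e(1)[of n]] set_less_trans[of "e n" "e k" "e n"]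
        by (auto simp: block_def)
    qed
    then have "F \<subseteq> e ` {..<k}" if "F \<subseteq> range e" "\<Union>F \<in> t" for F
      using that by (blast intro: Union_upper)
    then have "x \<in> FU (e ` {..<k})" if "x \<in> t" for x
      using that tFU by (metis FU_E FU_I subsetD)
    then have "t \<subseteq> FU (e ` {..<k})" by (rule subsetI)
    then have \<Phi>: "\<Phi> t (D k)" using e(6)[of k] fin by (auto simp: Inv_def fin_collections_in_def)
    have "tail_after (range e) t \<subseteq> FU (D k)"
      using k_le e(5) by (auto simp: tail_after_def)
    then show ?thesis by (intro local[OF \<Phi> e(7) fin(2)] FU_least)
  qed
  then show ?thesis using e(7) subcollection_trans[OF e(8) D0'(2)] by (intro bexI[of _ "range e"]) auto
qed

section \<open>Hindman's theorem\<close>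

text \<open>Failure of largeness is one half of Hindman's alternative: some subcollection has no
  union in \<open>X\<close>. Only the large case then needs work.\<close>

definition large :: "nat set set \<Rightarrow> nat set set \<Rightarrow> bool"
  where "large X D \<longleftrightarrow> (\<forall>D'\<in>inf_collections. D' \<preceq> D \<longrightarrow> FU D' \<inter> X \<noteq> {})"

lemma large_hereditary: "large X D \<Longrightarrow> D' \<preceq> D \<Longrightarrow> large X D'"
  unfolding large_def using subcollection_trans by blast

lemma large_superset: "large X D \<Longrightarrow> X \<inter> FU D \<subseteq> Y \<Longrightarrow> large Y D"
  unfolding large_def by (fastforce simp: subcollection_iff_FU)

text \<open>If \<open>Z e\<close> is not large, some \<open>D'\<close> avoids it, and the union of
  the remaining pieces is still large below \<open>D'\<close>.\<close>

lemma large_finite_UN: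
  assumes "finite E" "D \<in> inf_collections" "large (\<Union>e\<in>E. Z e) D"
  shows "\<exists>e\<in>E. \<exists>D'\<in>inf_collections. D' \<preceq> D \<and> large (Z e) D'"
  using assms
proof (induction E arbitrary: D rule: finite_induct)
  case empty
  then show ?case using subcollection_refl by (auto simp: large_def)
next
  case (insert e E)
  show ?case
  proof (cases "large (Z e) D")
    case True
    then show ?thesis using insert.prems(1) subcollection_refl by blast
  next
    case False
    then obtain D' where D': "D' \<in> inf_collections" "D' \<preceq> D" "FU D' \<inter> Z e = {}"
      by (auto simp: large_def)
    have "large (\<Union>e\<in>E. Z e) D'"
      using large_superset[OF large_hereditary[OF insert.prems(2) D'(2)]] D'(3) by auto
    then show ?thesis using insert.IH[OF D'(1)] D'(2) subcollection_trans by blast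
  qed
qed

text \<open>Otherwise there is a sequence of \<open>x n\<close> whose union with any union of earlier terms avoids
  \<open>X\<close>; then so do all finite unions of the sets \<open>x (2 * n) \<union> x (2 * n + 1)\<close>.\<close>

lemma large_finite_cover:
  assumes D: "D \<in> inf_collections" and X: "large X D"
  shows "\<exists>E D'. finite E \<and> E \<subseteq> FU D \<and> D' \<in> inf_collections \<and> D' \<preceq> D \<and>
    (\<forall>x\<in>FU D'. \<exists>e\<in>E. x \<union> e \<in> X)"
proof (rule ccontr)
  assume contra: "\<not> ?thesis"
  define P where "P f n r \<longleftrightarrow> r \<in> FU D \<and> (\<forall>i<n. f i \<lless> r) \<and>
    (\<forall>H\<subseteq>f ` {..<n}. H \<noteq> {} \<longrightarrow> r \<union> \<Union>H \<notin> X)" for f :: "nat \<Rightarrow> nat set" and n r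
  have "\<exists>x. \<forall>n. P x n (x n)"
  proof (rule dependent_wellorder_choice)
    fix r and f g :: "nat \<Rightarrow> nat set" and n :: nat assume "\<And>m. m < n \<Longrightarrow> f m = g m"
    then have "f ` {..<n} = g ` {..<n}" "\<forall>i<n. f i = g i" by (auto intro!: image_cong)
    then show "P f n r = P g n r" by (simp add: P_def)
  next
    fix n :: nat and f :: "nat \<Rightarrow> nat set" assume IH: "\<And>m. m < n \<Longrightarrow> P f m (f m)"
    let ?h = "f ` {..<n}"
    have h: "?h \<subseteq> FU D" using IH by (auto simp: P_def)
    have "finite (\<Union>?h)" using h block_FU[OF D] by (fastforce simp: block_def)
    then have "tail_after D ?h \<in> inf_collections" using D tail_after_inf_collections by blast
    moreover have "finite (FU ?h)" "FU ?h \<subseteq> FU D" using h by (auto intro: finite_FU dest: FU_least)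
    \<comment> \<open>The assumed failure is applied to the finite set of all unions of earlier
      terms and to the tail beyond them.\<close>
    ultimately have "\<not> (\<forall>x\<in>FU (tail_after D ?h). \<exists>e\<in>FU ?h. x \<union> e \<in> X)"
      using contra[simplified, rule_format, of "FU ?h" "tail_after D ?h"] tail_after_subcollection
      by simp
    then obtain r where r: "r \<in> FU (tail_after D ?h)" "\<forall>e\<in>FU ?h. r \<union> e \<notin> X"
      by blast
    have "P f n r" unfolding P_def
    proof (intro conjI allI impI)
      fix H assume "H \<subseteq> ?h" "H \<noteq> {}"
      then show "r \<union> \<Union>H \<notin> X" using r(2) FU_I[of H ?h] finite_subset[of H ?h] by auto
    qed (use r(1) in \<open>auto simp: FU_tail_after set_less_Union_left\<close>)
    then show "\<exists>r. P f n r" ..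
  qed
  then obtain x where P: "\<And>n. P x n (x n)" by blast
  have x: "x n \<in> FU D" "m < n \<Longrightarrow> x m \<lless> x n"
    "H \<subseteq> x ` {..<n} \<Longrightarrow> H \<noteq> {} \<Longrightarrow> x n \<union> \<Union>H \<notin> X" for m n H
    using P[of n] by (auto simp: P_def)
  \<comment> \<open>A single \<open>x n\<close> may lie in \<open>X\<close>. Pairing neighbours
    ensures that the last term of any union is joined with an earlier one.\<close>
  define y where "y n = x (2 * n) \<union> x (2 * n + 1)" for n
  have b: "block (y n)" for n using block_FU[OF D FU_Un] x(1) by (simp add: y_def)
  moreover have "y n \<lless> y (Suc n)" for n
    using x(2)[of "2*n" "2*n+2"] x(2)[of "2*n" "2*n+3"] x(2)[of "2*n+1" "2*n+2"]
      x(2)[of "2*n+1" "2*n+3"]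
    by (auto simp: y_def set_less_def numeral_3_eq_3)
  ultimately have "range y \<in> inf_collections" by (rule range_inf_collections)
  moreover have "range y \<preceq> D" using FU_Un x(1) by (auto simp: y_def subcollection_def)
  ultimately obtain z where z: "z \<in> FU (range y)" "z \<in> X" using X by (auto simp: large_def)
  then obtain J where J: "z = \<Union>(y ` J)" "finite J" "J \<noteq> {}"
    by (metis FU_E finite_subset_image image_is_empty)
  define m where "m = Max J"
  have m: "m \<in> J" "\<And>j. j \<in> J \<Longrightarrow> j \<le> m" using J by (auto simp: m_def)
  \<comment> \<open>The indices other than \<open>2 * m + 1\<close> that occur in \<open>z\<close>;
    the index \<open>2 * m\<close> keeps this set nonempty.\<close>
  define I where "I = insert (2 * m) (\<Union>j\<in>J - {m}. {2 * j, 2 * j + 1})"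
  have "i < 2 * m + 1" if "i \<in> I" for i
  proof -
    have "j < m" if "j \<in> J - {m}" for j using m(2)[of j] that by auto
    then show ?thesis using that by (fastforce simp: I_def)
  qed
  then have "x ` I \<subseteq> x ` {..<2 * m + 1}" by auto
  then have "x (2 * m + 1) \<union> \<Union>(x ` I) \<notin> X" by (rule x(3)) (simp add: I_def)
  moreover have "z = y m \<union> \<Union>(y ` (J - {m}))" using J(1) m(1) by auto
  then have "z = x (2 * m + 1) \<union> \<Union>(x ` I)" by (auto simp: I_def y_def)
  ultimately show False using z(2) by simp
qed

text \<open>The sets that stay in \<open>X\<close> after joining any union from \<open>h\<close>.
  The choice \<open>H = {}\<close> is allowed, whence \<open>shifts X h\<close> is contained in
  \<open>X\<close>.\<close>

definition shifts :: "nat set set \<Rightarrow> nat set set \<Rightarrow> nat set set"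
  where "shifts X h = {x. \<forall>H\<subseteq>h. x \<union> \<Union>H \<in> X}"

lemma shifts_empty: "shifts X {} = X"
  by (simp add: shifts_def)

lemma shifts_subset: "shifts X h \<subseteq> X"
  unfolding shifts_def by (auto dest: spec[of _ "{}"])

text \<open>Subsets of \<open>insert e h\<close> are split by whether they contain \<open>e\<close>.
  In this form, adding a block is one application of \<open>large_shift\<close> to
  \<open>shifts X h\<close>.\<close>

lemma shifts_insert: "shifts X (insert e h) = {x \<in> shifts X h. x \<union> e \<in> shifts X h}"
proof -
  have "(\<forall>H\<subseteq>insert e h. Q (\<Union>H)) \<longleftrightarrow> (\<forall>H\<subseteq>h. Q (\<Union>H) \<and> Q (e \<union> \<Union>H))"
    for Q :: "nat set \<Rightarrow> bool"
  proof (intro iffI allI impI)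
    fix H assume "\<forall>H\<subseteq>insert e h. Q (\<Union>H)" "H \<subseteq> h"
    then show "Q (\<Union>H) \<and> Q (e \<union> \<Union>H)" by (metis Union_insert insert_mono subset_insertI2)
  next
    fix H assume Q: "\<forall>H\<subseteq>h. Q (\<Union>H) \<and> Q (e \<union> \<Union>H)" and H: "H \<subseteq> insert e h"
    show "Q (\<Union>H)"
    proof (cases "e \<in> H")
      case True
      then have "\<Union>H = e \<union> \<Union>(H - {e})" by auto
      then show ?thesis using Q H by (metis subset_insert_iff)
    next
      case False
      then show ?thesis using Q H by (metis subset_insert)
    qed
  qed
  from this[of "\<lambda>y. _ \<union> y \<in> X"] show ?thesis by (auto simp: shifts_def Un_assoc)
qed

text \<open>The finite set \<open>E\<close> from \<open>large_finite_cover\<close> splits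
  \<open>X\<close>, within \<open>FU D1\<close>, into finitely many pieces
  \<open>{x \<in> X. x \<union> e \<in> X}\<close>, and one of them is large further down.\<close>

lemma large_shift:
  assumes D: "D \<in> inf_collections" and X: "large X D"
  shows "\<exists>e\<in>FU D. \<exists>D'\<in>inf_collections. D' \<preceq> D \<and> large {x \<in> X. x \<union> e \<in> X} D'"
proof -
  obtain E D1 where E: "finite E" "E \<subseteq> FU D" "D1 \<in> inf_collections" "D1 \<preceq> D"
    "\<forall>x\<in>FU D1. \<exists>e\<in>E. x \<union> e \<in> X"
    using large_finite_cover[OF assms] by blast
  have "large (\<Union>e\<in>E. {x \<in> X. x \<union> e \<in> X}) D1"
    using E(5) by (intro large_superset[OF large_hereditary[OF X E(4)]]) auto
  from large_finite_UN[OF E(1,3) this] obtain e D'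
    where e: "e \<in> E" "D' \<in> inf_collections" "D' \<preceq> D1" "large {x \<in> X. x \<union> e \<in> X} D'" by blast
  then show ?thesis
    using E(2) subcollection_trans[OF e(3) E(4)] by (intro bexI[of _ e] bexI[of _ D']) auto
qed

lemma finite_subset_chain:
  assumes "F \<subseteq> range e" "finite F"
  obtains n :: nat where "F \<subseteq> e ` {..<n}"
proof -
  obtain J where "finite J" "F = e ` J" using assms by (metis finite_subset_image)
  then show thesis using that finite_nat_iff_bounded[of J] by blast
qed

text \<open>Now the shift itself must lie in \<open>X\<close>. Iterating \<open>large_shift\<close>
  gives a chain along which all shifts stay large; largeness of \<open>X\<close> puts a finite union
  \<open>z\<close> of its blocks into \<open>X\<close>, and the shifts by those blocks include the
  shift by \<open>z\<close>.\<close>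

lemma large_shift_member:
  assumes D: "D \<in> inf_collections" and X: "large X D"
  shows "\<exists>e\<in>FU D \<inter> X. \<exists>D'\<in>inf_collections. D' \<preceq> D \<and> large {x \<in> X. x \<union> e \<in> X} D'"
proof (rule fusion[of D "\<lambda>h D. large (shifts X h) D"])
  show "\<exists>e\<in>FU D. \<exists>D'\<in>inf_collections. D' \<preceq> D \<and> large (shifts X (insert e h)) D'"
    if "D \<in> inf_collections" "large (shifts X h) D" for h D
    unfolding shifts_insert using large_shift[OF that] .
next
  fix e :: "nat \<Rightarrow> nat set" and D'
  assume e: "\<And>n. D' n \<in> inf_collections" "\<And>n. D' n \<preceq> D"
    "\<And>n. large (shifts X (e ` {..<n})) (D' n)" "range e \<in> inf_collections" "range e \<preceq> D"
  obtain z where z: "z \<in> FU (range e)" "z \<in> X" using X e(4,5) by (auto simp: large_def)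
  obtain F where F: "z = \<Union>F" "F \<subseteq> range e" "finite F" using z(1) by (rule FU_E)
  obtain n where n: "F \<subseteq> e ` {..<n}" using finite_subset_chain[OF F(2,3)] .
  have "large {x \<in> X. x \<union> z \<in> X} (D' n)"
    using n F(1) shifts_subset[of X] by (intro large_superset[OF e(3)[of n]]) (auto simp: shifts_def)
  moreover have "z \<in> FU D" using z(1) e(5) by (auto simp: subcollection_iff_FU)
  ultimately show ?thesis using z(2) by (intro bexI[of _ z] bexI[of _ "D' n"]) (auto simp: e(1,2))
next
  show "large (shifts X h) D'" if "large (shifts X h) D" "D' \<preceq> D" for h D D'
    by (rule large_hereditary[OF that])
qed (use D X in \<open>simp_all add: shifts_empty\<close>)

text \<open>For large \<open>X\<close>, fusion picks each new block \<open>e\<close> in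
  \<open>shifts X h\<close>. Then \<open>e\<close> and its unions with earlier blocks lie in
  \<open>X\<close>, so \<open>FU h \<subseteq> X\<close> persists and passes to the whole
  chain.\<close>

theorem hindman:
  assumes D: "D \<in> inf_collections"
  shows "\<exists>D'\<in>inf_collections. D' \<preceq> D \<and> (FU D' \<subseteq> X \<or> FU D' \<inter> X = {})"
proof (cases "large X D")
  case True
  show ?thesis
  proof (rule fusion[of D "\<lambda>h D. large (shifts X h) D \<and> FU h \<subseteq> X"])
    fix h D assume "D \<in> inf_collections" and h: "large (shifts X h) D \<and> FU h \<subseteq> X"
    then obtain e D' where e: "e \<in> FU D" "e \<in> shifts X h" "D' \<in> inf_collections" "D' \<preceq> D"
        "large (shifts X (insert e h)) D'"
      using large_shift_member[of D "shifts X h"] unfolding shifts_insert by blast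
    have "FU (insert e h) \<subseteq> X"
    proof
      fix x assume "x \<in> FU (insert e h)"
      then obtain F where F: "x = \<Union>F" "F \<subseteq> insert e h" "finite F" "F \<noteq> {}" by (rule FU_E)
      show "x \<in> X"
      proof (cases "e \<in> F")
        case True
        then have "x = e \<union> \<Union>(F - {e})" using F(1) by auto
        then show ?thesis using e(2) F(2) unfolding shifts_def by blast
      next
        case False
        then show ?thesis using F h FU_I[of F h] by auto
      qed
    qed
    then show "\<exists>e\<in>FU D. \<exists>D'\<in>inf_collections. D' \<preceq> D \<and>
        large (shifts X (insert e h)) D' \<and> FU (insert e h) \<subseteq> X"
      using e by blast
  next
    fix e :: "nat \<Rightarrow> nat set" and D'
    assume e: "\<And>n. large (shifts X (e ` {..<n})) (D' n) \<and> FU (e ` {..<n}) \<subseteq> X"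
      "range e \<in> inf_collections" "range e \<preceq> D"
    have "FU (range e) \<subseteq> X"
    proof
      fix x assume "x \<in> FU (range e)"
      then obtain F where F: "x = \<Union>F" "F \<subseteq> range e" "finite F" "F \<noteq> {}" by (rule FU_E)
      obtain n where "F \<subseteq> e ` {..<n}" using finite_subset_chain[OF F(2,3)] .
      then show "x \<in> X" using e(1)[of n] F FU_I by blast
    qed
    then show ?thesis using e(2,3) by blast
  next
    show "large (shifts X h) D' \<and> FU h \<subseteq> X"
      if "large (shifts X h) D \<and> FU h \<subseteq> X" "D' \<preceq> D" for h D D'
      using large_hereditary[OF conjunct1[OF that(1)] that(2)] that(1) by simp
  qed (use D True in \<open>simp_all add: shifts_empty FU_def\<close>)
next
  case False
  then show ?thesis by (auto simp: large_def)
qed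

section \<open>The Ramsey dichotomy\<close>

text \<open>A basic set depends on its second argument only through the unions lying beyond
  \<open>u\<close>; this provides the locality needed in \<open>diagonal_collection\<close>.\<close>

lemma basic_set_local: "FU (tail_after D' u) \<subseteq> FU D \<Longrightarrow> basic_set u D' \<subseteq> basic_set u D"
  unfolding basic_set_def subcollection_def FU_tail_after by (auto simp: tail_after_def)

lemma basic_set_mono: "D' \<preceq> D \<Longrightarrow> basic_set u D' \<subseteq> basic_set u D"
  by (rule basic_set_local) (auto simp: FU_tail_after subcollection_iff_FU)

section \<open>Extending finite collections and initial segments\<close>

lemma insert_fin_collections:
  assumes "t \<in> fin_collections" "block x" "\<Union>t \<lless> x"
  shows "insert x t \<in> fin_collections"
proof -
  obtain ss where "t = set ss" "\<forall>s\<in>set ss. block s" "sorted_wrt (\<lless>) ss"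
    using assms(1) by (auto simp: fin_collections_def)
  then show ?thesis unfolding fin_collections_def using assms(2,3)
    by (intro CollectI exI[of _ "ss @ [x]"]) (auto simp: sorted_wrt_append set_less_Union_left)
qed

text \<open>Collections grow at the right end, matching the one-block extensions along which badness
  is inherited.\<close>

lemma fin_collections_induct [consumes 1, case_names empty insert]:
  assumes "t \<in> fin_collections" "P {}"
    and "\<And>t x. t \<in> fin_collections \<Longrightarrow> \<Union>t \<lless> x \<Longrightarrow> P t \<Longrightarrow> P (insert x t)"
  shows "P t"
proof -
  have "(\<forall>s\<in>set ss. block s) \<Longrightarrow> sorted_wrt (\<lless>) ss \<Longrightarrow> P (set ss)" for ss
  proof (induction ss rule: rev_induct)
    case (snoc x ss)
    then have "set ss \<in> fin_collections" by (auto simp: fin_collections_def sorted_wrt_append)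
    moreover have "\<Union>(set ss) \<lless> x"
      using snoc.prems by (auto simp: sorted_wrt_append set_less_Union_left)
    ultimately show ?case using assms(3)[of "set ss" x] snoc by (simp add: sorted_wrt_append)
  qed (simp add: assms(2))
  then show ?thesis using assms(1) by (auto simp: fin_collections_def)
qed

lemma not_initial_after:
  assumes "A \<in> inf_collections" "initial_segment u A" "G \<in> A" "G \<notin> u"
  shows "\<Union>u \<lless> G"
proof -
  have "F \<lless> G" if "F \<in> u" for F
    using inf_collections_cases[OF assms(1), of F G] assms that unfolding initial_segment_def by blast
  then show ?thesis by (simp add: set_less_Union_left)
qed

text \<open>The new member is the first one beyond \<open>u\<close>; any member before it is not
  beyond \<open>u\<close> and hence belongs to \<open>u\<close>.\<close>

lemma initial_segment_extend:
  assumes A: "A \<in> inf_collections" and u: "initial_segment u A" "finite (\<Union>u)"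
  obtains x where "x \<in> A" "\<Union>u \<lless> x" "initial_segment (insert x u) A"
proof -
  obtain e :: "nat \<Rightarrow> nat set"
    where e: "A = range e" "\<And>n. block (e n)" "\<And>m n. m < n \<longleftrightarrow> e m \<lless> e n"
    by (rule inf_collections_chain[OF A]) (rule that)
  define k where "k = (LEAST n. \<Union>u \<lless> e n)"
  have k: "\<Union>u \<lless> e k" unfolding k_def
    by (rule LeastI_ex, rule chain_unbounded[of e, OF e(2) e(3)[THEN iffD1, OF lessI] u(2)])
  have "G \<in> u" if G: "G \<in> A" "G \<lless> e k" for G
  proof -
    obtain j where j: "G = e j" "j < k" using G e(1,3) by auto
    then have "\<not> \<Union>u \<lless> G" using not_less_Least[of j] by (auto simp: k_def)
    then show ?thesis using not_initial_after[OF A u(1) G(1)] by blast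
  qed
  then have "initial_segment (insert (e k) u) A"
    using u(1) e(1) by (auto simp: initial_segment_def)
  then show thesis using that k e(1) by blast
qed

text \<open>The sets \<open>[u \<union> {x}, D]\<close>, with \<open>x\<close> built from
  \<open>D\<close> beyond \<open>u\<close>, cover \<open>[u, D]\<close>. Hence if all of them miss a
  family, so does \<open>[u, D]\<close>.\<close>

lemma basic_set_extend:
  assumes A: "A \<in> basic_set u D" and u: "u \<in> fin_collections"
  obtains x where "x \<in> FU D" "\<Union>u \<lless> x" "A \<in> basic_set (insert x u) D"
proof -
  have A': "A \<in> inf_collections" "initial_segment u A" "tail_after A u \<subseteq> FU D"
    using A by (auto simp: basic_set_def subcollection_def)
  obtain x where x: "x \<in> A" "\<Union>u \<lless> x" "initial_segment (insert x u) A"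
    using initial_segment_extend[OF A'(1,2) finite_Union_fin_collections[OF u]] .
  have "tail_after A (insert x u) \<subseteq> tail_after A u" by (auto simp: tail_after_def set_less_def)
  then have "A \<in> basic_set (insert x u) D"
    using A' x(3) by (auto simp: basic_set_def subcollection_def)
  moreover have "x \<in> FU D" using A'(3) x(1,2) by (auto simp: tail_after_def)
  ultimately show thesis using that x(2) by blast
qed

text \<open>As \<open>D\<close> lies beyond \<open>s\<close>, the members of \<open>t\<close> follow
  those of \<open>s\<close>. So \<open>s\<close> remains an initial segment, and members beyond
  \<open>s\<close> either are in \<open>t\<close> or follow \<open>s \<union> t\<close>; both kinds
  are built from \<open>D\<close>.\<close>

lemma basic_set_Un_subset:
  assumes D: "D \<in> inf_collections" and s: "\<forall>d\<in>D. \<Union>s \<lless> d" and t: "t \<subseteq> FU D"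
  shows "basic_set (s \<union> t) D \<subseteq> basic_set s D"
proof
  fix A assume "A \<in> basic_set (s \<union> t) D"
  then have A: "A \<in> inf_collections" "initial_segment (s \<union> t) A" "tail_after A (s \<union> t) \<subseteq> FU D"
    by (auto simp: basic_set_def subcollection_def)
  have b: "block G" if "G \<in> A" for G using block_inf_collections[OF A(1) that] .
  have less: "F \<lless> G" if "F \<in> s" "G \<in> t" for F G
    using set_less_FU[OF s, of G] t that by (auto simp: set_less_Union_left)
  have "G \<in> s" if "F \<in> s" "G \<in> A" "G \<lless> F" for F G
  proof (rule ccontr)
    assume "G \<notin> s"
    then have "G \<in> t" using A(2) that unfolding initial_segment_def by blast
    then have "F \<lless> G" using less that(1) by blast
    moreover have "F \<in> A" using A(2) that by (auto simp: initial_segment_def)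
    ultimately show False
      using that(2,3) b set_less_block[of G] set_less_trans[of G F G] by (auto simp: block_def)
  qed
  then have "initial_segment s A" using A(2) by (auto simp: initial_segment_def)
  moreover have "G \<in> FU D" if "G \<in> A" "\<Union>s \<lless> G" for G
  proof (cases "G \<in> s \<union> t")
    case True
    then show ?thesis
      using t that b[of G] set_less_block[of G] by (auto simp: set_less_Union_left)
  next
    case False
    then have "G \<in> tail_after A (s \<union> t)"
      using not_initial_after[OF A(1,2) that(1)] that(1) by (simp add: tail_after_def)
    then show ?thesis using A(3) by blast
  qed
  ultimately show "A \<in> basic_set s D"
    using A(1) by (auto simp: basic_set_def subcollection_def tail_after_def)
qed

lemma Un_fin_collections:
  assumes "s \<in> fin_collections" "t \<in> fin_collections" "\<Union>s \<lless> \<Union>t"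
  shows "s \<union> t \<in> fin_collections"
proof -
  obtain ss ts where "s = set ss" "\<forall>s\<in>set ss. block s" "sorted_wrt (\<lless>) ss"
    "t = set ts" "\<forall>s\<in>set ts. block s" "sorted_wrt (\<lless>) ts"
    using assms(1,2) by (auto simp: fin_collections_def)
  then show ?thesis unfolding fin_collections_def using assms(3)
    by (intro CollectI exI[of _ "ss @ ts"])
      (auto simp: sorted_wrt_append set_less_Union_left set_less_Union_right)
qed

theorem ramsey_dichotomy:
  assumes s: "s \<in> fin_collections" and D: "D \<in> inf_collections"
  shows "\<exists>D1\<in>inf_collections. D1 \<preceq> D \<and>
    (basic_set s D1 \<inter> U = {} \<or> basic_set s D1 \<subseteq> ellentuck closure_of U)"
proof -
  define kill where "kill u D \<longleftrightarrow> basic_set u D \<inter> U = {}" for u D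
  have kill_mono: "kill u D'" if "kill u D" "D' \<preceq> D" for u D D'
    using that basic_set_mono unfolding kill_def by blast
  \<comment> \<open>Decisions are dense by the form of this disjunction: where the second part
    fails, some smaller collection satisfies the first.\<close>
  define decided where "decided t D \<longleftrightarrow> kill (s \<union> t) D \<or>
    (\<forall>D'\<in>inf_collections. D' \<preceq> D \<longrightarrow> \<not> kill (s \<union> t) D')" for t D
  have "\<exists>D0\<in>inf_collections. D0 \<preceq> tail_after D s \<and> (\<forall>t\<in>fin_collections_in D0. decided t D0)"
  proof (rule diagonal_collection)
    \<comment> \<open>Starting beyond \<open>s\<close> ensures that \<open>s \<union> t\<close> is a
      finite collection for every \<open>t\<close> built from \<open>D0\<close>.\<close>
    show "tail_after D s \<in> inf_collections"
      using tail_after_inf_collections[OF D] finite_Union_fin_collections[OF s] .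
  next
    fix t E E' assume t: "decided t E" "finite (\<Union>t)" and E: "FU (tail_after E' t) \<subseteq> FU E"
    have "kill (s \<union> t) E'" if "kill (s \<union> t) E"
    proof -
      have "FU (tail_after E' (s \<union> t)) \<subseteq> FU E" using E by (auto simp: FU_tail_after set_less_def)
      then show ?thesis using that basic_set_local unfolding kill_def by blast
    qed
    \<comment> \<open>\<open>E'\<close> lies below \<open>E\<close> only beyond \<open>t\<close>. A
      killing \<open>F\<close> below \<open>E'\<close> is therefore replaced by its tail beyond
      \<open>t\<close>, which lies below \<open>E\<close> and still kills.\<close>
    moreover have "\<exists>F\<in>inf_collections. F \<preceq> E \<and> kill (s \<union> t) F"
      if F: "F \<in> inf_collections" "F \<preceq> E'" "kill (s \<union> t) F" for F
    proof (intro bexI conjI)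
      show "tail_after F t \<in> inf_collections" using tail_after_inf_collections F(1) t(2) .
      show "tail_after F t \<preceq> E" using E F(2) by (auto simp: subcollection_iff_FU FU_tail_after)
      show "kill (s \<union> t) (tail_after F t)" using kill_mono[OF F(3) tail_after_subcollection] .
    qed
    ultimately show "decided t E'" using t(1) unfolding decided_def by blast
  next
    fix t E assume "E \<in> inf_collections"
    then show "\<exists>E'\<in>inf_collections. E' \<preceq> E \<and> decided t E'"
      unfolding decided_def using subcollection_refl by blast
  qed
  then obtain D0 where D0: "D0 \<in> inf_collections" "D0 \<preceq> tail_after D s"
    "\<And>t. t \<in> fin_collections_in D0 \<Longrightarrow> decided t D0" by blast
  have "D0 \<preceq> D" using D0(2) tail_after_subcollection subcollection_trans by blast
  have s_less: "\<Union>s \<lless> x" if "x \<in> FU D0" for x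
    using that D0(2) by (auto simp: subcollection_iff_FU FU_tail_after)
  define bad where "bad t \<longleftrightarrow> (\<forall>D'\<in>inf_collections. D' \<preceq> D0 \<longrightarrow> \<not> kill (s \<union> t) D')" for t
  have bad: "bad t \<or> kill (s \<union> t) D0" if "t \<in> fin_collections_in D0" for t
    using D0(3)[OF that] unfolding decided_def bad_def by blast
  have "{} \<in> fin_collections_in D0" by (simp add: fin_collections_in_def fin_collections_def)
  then consider "kill s D0" | "bad {}" using bad by fastforce
  then show ?thesis
  proof cases
    case 1
    then show ?thesis using D0(1) \<open>D0 \<preceq> D\<close> unfolding kill_def by blast
  next
    case 2
    define ext where "ext t E \<longleftrightarrow> (t \<in> fin_collections_in D0 \<longrightarrow> bad t \<longrightarrow>
      (\<forall>x\<in>FU E. \<Union>t \<lless> x \<longrightarrow> bad (insert x t)))" for t E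
    have "\<exists>D1\<in>inf_collections. D1 \<preceq> D0 \<and> (\<forall>t\<in>fin_collections_in D1. ext t D1)"
    proof (rule diagonal_collection[OF D0(1)])
      show "ext t E'" if "ext t E" "FU (tail_after E' t) \<subseteq> FU E" for t E E'
        using that by (auto simp: ext_def FU_tail_after)
    next
      fix t E assume t: "t \<in> fin_collections" and E: "E \<in> inf_collections" "E \<preceq> D0"
      show "\<exists>E'\<in>inf_collections. E' \<preceq> E \<and> ext t E'"
      proof (cases "t \<in> fin_collections_in D0 \<and> bad t")
        case False
        then show ?thesis using E(1) subcollection_refl by (auto simp: ext_def)
      next
        case True
        have "tail_after E t \<in> inf_collections"
          using tail_after_inf_collections[OF E(1)] finite_Union_fin_collections[OF t] .
        \<comment> \<open>Blocks are coloured by whether adding them to \<open>t\<close> gives a bad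
          collection.\<close>
        from hindman[OF this, of "{x. bad (insert x t)}"]
        obtain E' where E': "E' \<in> inf_collections" "E' \<preceq> tail_after E t"
          "FU E' \<subseteq> {x. bad (insert x t)} \<or> FU E' \<inter> {x. bad (insert x t)} = {}" by blast
        have "E' \<preceq> E" "E' \<preceq> D0"
          using E'(2) E(2) tail_after_subcollection subcollection_trans by blast+
        \<comment> \<open>One bad extension excludes the second alternative. If there were none,
          \<open>D0\<close> and hence \<open>E'\<close> would kill every one-block extension of
          \<open>s \<union> t\<close> by a block of \<open>FU E'\<close>; these cover
          \<open>[s \<union> t, E']\<close>, so \<open>E'\<close> would kill
          \<open>s \<union> t\<close>, against badness of \<open>t\<close>.\<close>
        have "\<exists>x\<in>FU E'. bad (insert x t)"
        proof (rule ccontr)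
          assume not_bad: "\<not> ?thesis"
          have "\<not> kill (s \<union> t) E'" using True E'(1) \<open>E' \<preceq> D0\<close> by (auto simp: bad_def)
          then obtain A where A: "A \<in> basic_set (s \<union> t) E'" "A \<in> U" by (auto simp: kill_def)
          have "\<Union>s \<lless> \<Union>t"
            using s_less True by (auto simp: fin_collections_in_def set_less_Union_right)
          then have "s \<union> t \<in> fin_collections" using Un_fin_collections s t by blast
          then obtain x where x: "x \<in> FU E'" "\<Union>(s \<union> t) \<lless> x"
              "A \<in> basic_set (insert x (s \<union> t)) E'"
            using basic_set_extend[OF A(1)] by blast
          have "x \<in> FU D0" using x(1) \<open>E' \<preceq> D0\<close> by (auto simp: subcollection_iff_FU)
          moreover have "\<Union>t \<lless> x" using x(2) by (auto simp: set_less_def)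
          ultimately have "insert x t \<in> fin_collections_in D0"
            using True t insert_fin_collections block_FU[OF D0(1)]
            by (auto simp: fin_collections_in_def)
          then have "kill (s \<union> insert x t) D0" using bad not_bad x(1) by blast
          then have "kill (insert x (s \<union> t)) E'" using kill_mono \<open>E' \<preceq> D0\<close> by simp
          then show False using x(3) A(2) by (auto simp: kill_def)
        qed
        then have "ext t E'" using E'(3) by (auto simp: ext_def)
        then show ?thesis using E'(1) \<open>E' \<preceq> E\<close> by blast
      qed
    qed
    then obtain D1 where D1: "D1 \<in> inf_collections" "D1 \<preceq> D0"
      "\<And>t. t \<in> fin_collections_in D1 \<Longrightarrow> ext t D1" by blast
    have FU_D1: "FU D1 \<subseteq> FU D0" using D1(2) by (simp add: subcollection_iff_FU)
    have all_bad: "bad t" if "t \<in> fin_collections" "t \<subseteq> FU D1" for t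
      using that
    proof (induction rule: fin_collections_induct)
      case (insert t x)
      then show ?case using D1(3)[of t] FU_D1 by (auto simp: ext_def fin_collections_in_def)
    qed (rule 2)
    have "A \<in> ellentuck closure_of U" if A: "A \<in> basic_set s D1" for A
    proof -
      have A': "A \<in> inf_collections" "initial_segment s A" "tail_after A s \<subseteq> FU D1"
        using A by (auto simp: basic_set_def subcollection_def)
      \<comment> \<open>A neighbourhood \<open>[u, E]\<close> of \<open>A\<close> contains
        \<open>[s \<union> u, A]\<close>. The members of \<open>u\<close> outside \<open>s\<close>
        lie beyond \<open>s\<close> and form a bad collection, so this smaller neighbourhood meets
        \<open>U\<close>.\<close>
      have "\<exists>B\<in>U. B \<in> V" if V: "openin ellentuck V" "A \<in> V" for V
      proof -
        obtain u E where u: "u \<in> fin_collections" "A \<in> basic_set u E" "basic_set u E \<subseteq> V"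
          using V openin_ellentuck by blast
        have v: "initial_segment (s \<union> u) A"
          using A'(2) u(2) by (auto simp: basic_set_def initial_segment_def)
        have "finite u" using u(1) by (auto simp: fin_collections_def)
        then have "u - s \<in> fin_collections"
          using finite_subset_inf_collections[OF A'(1), of "u - s"] v
          by (auto simp: initial_segment_def)
        moreover have "u - s \<subseteq> tail_after A s"
          using not_initial_after[OF A'(1,2)] v by (auto simp: tail_after_def initial_segment_def)
        ultimately have "bad (u - s)" using all_bad A'(3) by blast
        moreover have tail: "tail_after A (s \<union> u) \<in> inf_collections"
          using tail_after_inf_collections[OF A'(1)] s u(1) finite_Union_fin_collections by simp
        moreover have "tail_after A (s \<union> u) \<subseteq> tail_after A s"
          by (auto simp: tail_after_def set_less_def)
        then have "tail_after A (s \<union> u) \<preceq> D0" using A'(3) FU_D1 unfolding subcollection_def by blast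
        ultimately have "\<not> kill (s \<union> u) (tail_after A (s \<union> u))" by (simp add: bad_def)
        then obtain B where "B \<in> U" "B \<in> basic_set (s \<union> u) (tail_after A (s \<union> u))"
          by (auto simp: kill_def)
        then have "B \<in> basic_set (s \<union> u) A"
          using basic_set_mono[OF tail_after_subcollection] by blast
        then show ?thesis using basic_set_refine[OF u(2) v] u(3) \<open>B \<in> U\<close> by blast
      qed
      then show ?thesis using A'(1) by (auto simp: in_closure_of topspace_ellentuck)
    qed
    then show ?thesis using D1(1,2) \<open>D0 \<preceq> D\<close> subcollection_trans by blast
  qed
qed

theorem theorem4p2:
  fixes L :: "cord \<Rightarrow> nat \<Rightarrow> cord"
    and U :: "nat set set set"
    and s D :: "nat set set"
  assumes "fundamental_sequences L"
    and "U \<subseteq> inf_collections"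
    and "s \<in> fin_collections"
    and "D \<in> inf_collections"
  shows "(\<exists>D1\<in>inf_collections. D1 \<preceq> D \<and> basic_set s D1 \<subseteq> ellentuck closure_of U)
    \<or> (\<exists>\<xi>0. \<forall>\<xi>>\<xi>0. \<exists>D1\<in>inf_collections. D1 \<preceq> D \<and>
          (\<forall>t \<in> block_schreier L \<xi> \<inter> fin_collections_in D1.
             basic_set (s \<union> t) D1 \<subseteq> inf_collections - U))"
proof -
  \<comment> \<open>Passing to the tail puts \<open>D1\<close> beyond \<open>s\<close>, as
    \<open>basic_set_Un_subset\<close> requires.\<close>
  have "tail_after D s \<in> inf_collections"
    using tail_after_inf_collections assms(3,4) finite_Union_fin_collections by blast
  from ramsey_dichotomy[OF assms(3) this, of U]
  obtain D1 where D1: "D1 \<in> inf_collections" "D1 \<preceq> tail_after D s"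
    "basic_set s D1 \<inter> U = {} \<or> basic_set s D1 \<subseteq> ellentuck closure_of U" by blast
  have "D1 \<preceq> D" using D1(2) tail_after_subcollection subcollection_trans by blast
  show ?thesis
  proof (cases "basic_set s D1 \<subseteq> ellentuck closure_of U")
    case True
    then show ?thesis using D1(1) \<open>D1 \<preceq> D\<close> by blast
  next
    case False
    have "\<forall>d\<in>D1. \<Union>s \<lless> d" using D1(2) subset_FU by (auto simp: subcollection_iff_FU FU_tail_after)
    then have "basic_set (s \<union> t) D1 \<subseteq> inf_collections - U" if "t \<in> fin_collections_in D1" for t
      using basic_set_Un_subset[OF D1(1), of s t] that D1(3) False
      by (fastforce simp: fin_collections_in_def basic_set_def)
    then show ?thesis using D1(1) \<open>D1 \<preceq> D\<close> by blast
  qed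
qed

end
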